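(* Suppose that the $k$-resolvent $E_k$ exists and let $g\in L^1_{loc}(\mathbb R_+;H)$ be such that $E_k\ast g\in L^1_{loc}(\mathbb R_+;D(A))$. Then $$Gg(t)=g(t)+A\int_0^tE_k(t-s)g(s)\,ds,\qquad\text{a.a. }t\ge0,$$ is the unique mild solution of $u(t)=g(t)+\int_0^tk(t-s)Au(s)\,ds$. Conversely, suppose that $u$ is a mild solution of this equation with $g\in L^1_{loc}(\mathbb R_+;H)$. Then $E_k\ast g\in L^1_{loc}(\mathbb R_+;D(A))$ and $u=Gg$.
   Context: $H$ is a separable Hilbert space, $0\ne k\in L^1_{loc}(\mathbb R_+)$ is scalar, $(A,D(A))$ is a closed densely defined operator on $H$, and $D(A)$ carries the graph norm. $(a\ast b)(t)=\int_0^ta(t-s)b(s)ds$. $L^1_{loc}(\mathbb R_+;L_s(H))$ is the space of maps $E:\mathbb R_+\to L(H)$ with $t\mapsto E(t)x$ measurable for each $x\in H$ and $\|E(\cdot)\|_{L(H)}\in L^1_{loc}(\mathbb R_+)$. For $\rho\in L^1_{loc}(\mathbb R_+)$, a $\rho$-resolvent is a family $E_\rho\in L^1_{loc}(\mathbb R_+;L_s(H))$ such that, for a.a. $t\ge0$, $E_\rho(t)$ leaves $D(A)$ invariant, commutes with $A$ on $D(A)$, and $E_\rho(t)x=\rho(t)x+\int_0^tk(t-s)AE_\rho(s)x\,ds$ for each $x\in D(A)$; the $k$-resolvent is the case $\rho=k$. Given $g\in L^1_{loc}(\mathbb R_+;H)$, a mild solution of $u(t)=g(t)+\int_0^tk(t-s)Au(s)ds$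 is a function $u\in L^1_{loc}(\mathbb R_+;H)$ with $k\ast u\in L^1_{loc}(\mathbb R_+;D(A))$ and $u(t)=g(t)+A\int_0^tk(t-s)u(s)ds$ for a.a. $t\ge0$. *)

theory Defs
  imports "HOL-Analysis.Analysis"
begin

text \<open>
  A separable Hilbert space over the scalar field \<open>'s\<close>, which may be real or complex: a complete
  field with a multiplicative norm extending the one of the reals is isometrically isomorphic to one
  of these two (Gelfand--Mazur). For complex scalars, \<open>inner\<close> is the real part of the Hermitian
  product, which is recovered from it as \<open>norm_smul\<close> makes multiplication by the imaginary
  unit an isometry. Separability is \<open>second_countable_topology\<close>.
\<close>

locale separable_hilbert_space = vector_space smul
  for smul :: "'s::{real_normed_field,banach,second_countable_topology} \<Rightarrow>
    'h::{real_inner,banach,second_countable_topology} \<Rightarrow> 'h" +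
  assumes smul_of_real: "smul (of_real r) x = r *\<^sub>R x"
    and norm_smul: "norm (smul c x) = norm c * norm x"

lemma separable_hilbert_space_real:
  "separable_hilbert_space
    (scaleR :: real \<Rightarrow> 'h::{real_inner,banach,second_countable_topology} \<Rightarrow> 'h)"
  by unfold_locales (simp_all add: scaleR_add_right scaleR_add_left)

lemma separable_hilbert_space_complex:
  "separable_hilbert_space ((*) :: complex \<Rightarrow> complex \<Rightarrow> complex)"
  by unfold_locales (simp_all add: algebra_simps norm_mult scaleR_conv_of_real)

text \<open>
  Functions on the half-line are total functions on \<open>real\<close> of which only the values on \<open>{0..}\<close>
  matter. Measurability is with respect to the (complete) Lebesgue measure, so that changing a
  function on a null set is harmless.
\<close>

definition L1_loc :: "(real \<Rightarrow> 'b::{banach,second_countable_topology}) \<Rightarrow> bool" where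
  "L1_loc f \<longleftrightarrow> (\<forall>T\<ge>0. set_integrable lebesgue {0..T} f)"

definition AE_halfline :: "(real \<Rightarrow> bool) \<Rightarrow> bool"  (binder "\<forall>\<^sub>a\<^sub>e " 10) where
  "AE_halfline P \<longleftrightarrow> (AE t in lebesgue. 0 \<le> t \<longrightarrow> P t)"

definition convol ::
  "('a \<Rightarrow> 'b \<Rightarrow> 'c::{banach,second_countable_topology}) \<Rightarrow> (real \<Rightarrow> 'a) \<Rightarrow> (real \<Rightarrow> 'b) \<Rightarrow> real \<Rightarrow> 'c" where
  "convol bop a b t = (LINT s:{0..t}|lebesgue. bop (a (t - s)) (b s))"

text \<open>
  An unbounded operator is a total function \<open>A\<close> together with its domain \<open>D\<close>; the values of \<open>A\<close>
  outside \<open>D\<close> are irrelevant.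
\<close>

definition closed_densely_defined ::
  "('s::field \<Rightarrow> 'h::real_normed_vector \<Rightarrow> 'h) \<Rightarrow> ('h \<Rightarrow> 'h) \<Rightarrow> 'h set \<Rightarrow> bool" where
  "closed_densely_defined smul A D \<longleftrightarrow>
     module.subspace smul D \<and>
     (\<forall>x\<in>D. \<forall>y\<in>D. A (x + y) = A x + A y) \<and>
     (\<forall>c. \<forall>x\<in>D. A (smul c x) = smul c (A x)) \<and>
     closed ((\<lambda>x. (x, A x)) ` D) \<and>
     closure D = UNIV"

text \<open>
  \<open>D\<close> with the graph norm is isomorphic to the graph of \<open>A\<close> under \<open>x \<mapsto> (x, A x)\<close>, so measurability
  and local integrability of a \<open>D\<close>-valued \<open>v\<close> are those of both \<open>v\<close> and \<open>A v\<close>.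
\<close>

definition L1_loc_dom ::
  "('h::{banach,second_countable_topology} \<Rightarrow> 'h) \<Rightarrow> 'h set \<Rightarrow> (real \<Rightarrow> 'h) \<Rightarrow> bool" where
  "L1_loc_dom A D v \<longleftrightarrow> (\<forall>\<^sub>a\<^sub>e t. v t \<in> D) \<and> L1_loc v \<and> L1_loc (\<lambda>t. A (v t))"

text \<open>
  The type of \<open>E\<close> only provides bounded real-linear operators, hence the homogeneity condition.
\<close>

definition L1_loc_strong ::
  "('s \<Rightarrow> 'h::{banach,second_countable_topology} \<Rightarrow> 'h) \<Rightarrow> (real \<Rightarrow> 'h \<Rightarrow>\<^sub>L 'h) \<Rightarrow> bool" where
  "L1_loc_strong smul E \<longleftrightarrow>
     (\<forall>t\<ge>0. \<forall>c x. blinfun_apply (E t) (smul c x) = smul c (blinfun_apply (E t) x)) \<and>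
     (\<forall>x. set_borel_measurable lebesgue {0..} (\<lambda>t. blinfun_apply (E t) x)) \<and>
     L1_loc (\<lambda>t. norm (E t))"

definition resolvent_family ::
  "('s \<Rightarrow> 'h::{banach,second_countable_topology} \<Rightarrow> 'h) \<Rightarrow> (real \<Rightarrow> 's) \<Rightarrow> ('h \<Rightarrow> 'h) \<Rightarrow> 'h set \<Rightarrow>
    (real \<Rightarrow> 's) \<Rightarrow> (real \<Rightarrow> 'h \<Rightarrow>\<^sub>L 'h) \<Rightarrow> bool" where
  "resolvent_family smul k A D \<rho> E \<longleftrightarrow>
     L1_loc_strong smul E \<and>
     (\<forall>\<^sub>a\<^sub>e t. \<forall>x\<in>D.
        blinfun_apply (E t) x \<in> D \<and>
        A (blinfun_apply (E t) x) = blinfun_apply (E t) (A x) \<and>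
        blinfun_apply (E t) x =
          smul (\<rho> t) x + convol smul k (\<lambda>s. A (blinfun_apply (E s) x)) t)"

definition mild_solution ::
  "('s \<Rightarrow> 'h::{banach,second_countable_topology} \<Rightarrow> 'h) \<Rightarrow> (real \<Rightarrow> 's) \<Rightarrow> ('h \<Rightarrow> 'h) \<Rightarrow> 'h set \<Rightarrow>
    (real \<Rightarrow> 'h) \<Rightarrow> (real \<Rightarrow> 'h) \<Rightarrow> bool" where
  "mild_solution smul k A D g u \<longleftrightarrow>
     L1_loc u \<and>
     L1_loc_dom A D (convol smul k u) \<and>
     (\<forall>\<^sub>a\<^sub>e t. u t = g t + A (convol smul k u t))"

definition solution_map ::
  "('h::{banach,second_countable_topology} \<Rightarrow> 'h) \<Rightarrow> (real \<Rightarrow> 'h \<Rightarrow>\<^sub>L 'h) \<Rightarrow>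
    (real \<Rightarrow> 'h) \<Rightarrow> real \<Rightarrow> 'h" where
  "solution_map A E g t = g t + A (convol blinfun_apply E g t)"

end

theory Submission
  imports Defs
begin

text \<open>
  Write \<open>*\<close> for convolution on the half-line. The proof rests on the operators
  \<open>(k * E)(t) x = \<integral> k(t - s) E(s) x ds\<close>. For \<open>x \<in> D\<close> the resolvent equation, together with the
  closedness of \<open>A\<close>, says \<open>A (k * E)(t) x = E(t) x - k(t) x = (k * E)(t) A x\<close>. The first
  equality involves no \<open>A x\<close> on its right-hand side, so by density of \<open>D\<close> and closedness of \<open>A\<close> it
  extends to all \<open>x\<close>: for almost all \<open>t\<close> the operator \<open>(k * E)(t)\<close> maps the whole space into \<open>D\<close>
  (lemma \<open>kE_resolvent\<close>). Integrated against a locally integrable \<open>h\<close>, respectively a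
  locally integrable \<open>v\<close> with values in \<open>D\<close> and locally integrable \<open>A v\<close>, the two equalities become

    (1)  \<open>k * E * h \<in> D\<close> and \<open>A (k * E * h) = E * h - k * h\<close>,

    (2)  \<open>k * E * A v = E * v - k * v\<close>.

  Closedness also gives (3) \<open>A (k * v) = k * A v\<close>.

  Let \<open>E * g\<close> be \<open>D\<close>-valued as in the theorem and \<open>u = g + A (E * g)\<close>. By (3) and (1),
  \<open>k * u = k * g + A (k * E * g) = E * g\<close>, hence \<open>u = g + A (k * u)\<close>.

  Let conversely \<open>u\<close> be a mild solution and \<open>v = k * u\<close>, so that \<open>A v = u - g\<close>. By (2) and
  commutativity, \<open>k * E * u - k * E * g = E * v - k * v = k * E * u - k * v\<close>, so
  \<open>k * v = k * E * g\<close>. To recover \<open>v\<close> from this, apply \<open>A\<close> to both sides. By (3) the left-hand side becomes \<open>k * (u - g) = v - k * g\<close>, by (1) the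
  right-hand side becomes \<open>E * g - k * g\<close>, and therefore \<open>v = E * g\<close>.

  The measure theory needed is Fubini's theorem for these iterated convolutions. Since
  \<open>(t, s) \<mapsto> E(t - s) h(s)\<close> has to be jointly measurable, all functions are first replaced by Borel
  representatives on the whole line that vanish for \<open>t < 0\<close>; convolutions are then integrals over the
  line, and both sides of an almost everywhere identity are zero for negative times.
\<close>

section \<open>Integrals with values in a closed subspace\<close>

text \<open>
  Jensen's inequality on an arbitrary measure space: positive homogeneity takes the place of
  normalising the measure.
\<close>

lemma simple_bochner_integral_sublinear_le:
  fixes f :: "'a \<Rightarrow> 'b::{real_normed_vector}" and q :: "'b \<Rightarrow> real"
  assumes f: "Bochner_Integration.simple_bochner_integrable M f"
    and add: "\<And>x y. q (x + y) \<le> q x + q y"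
    and scale: "\<And>r x. 0 \<le> r \<Longrightarrow> q (r *\<^sub>R x) = r * q x"
  shows "q (Bochner_Integration.simple_bochner_integral M f) \<le> Bochner_Integration.simple_bochner_integral M (\<lambda>x. q (f x))"
proof -
  have q0: "q 0 = 0"
    using scale[of 0 0] by simp
  have sum_le: "q (sum h B) \<le> (\<Sum>b\<in>B. q (h b))" if "finite B" for h :: "'b \<Rightarrow> 'b" and B
    using that
  proof (induction B rule: finite_induct)
    case (insert x F)
    then show ?case using add[of "h x" "sum h F"] by simp
  qed (simp add: q0)
  have "finite (f ` space M)"
    using f by (auto simp: simple_function_def elim: simple_bochner_integrable.cases)
  then have "q (Bochner_Integration.simple_bochner_integral M f)
      \<le> (\<Sum>y\<in>f ` space M. q (measure M {x \<in> space M. f x = y} *\<^sub>R y))"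
    unfolding simple_bochner_integral_def by (rule sum_le)
  also have "\<dots> = (\<Sum>y\<in>f ` space M. measure M {x \<in> space M. f x = y} *\<^sub>R q y)"
    by (simp add: scale)
  also have "\<dots> = Bochner_Integration.simple_bochner_integral M (\<lambda>x. q (f x))"
    using f simple_bochner_integrable_compose2[where p="\<lambda>x y. q x", OF _ f f] q0
    by (intro simple_bochner_integral_partition[symmetric])
       (auto elim: simple_bochner_integrable.cases)
  finally show ?thesis .
qed

text \<open>
  The distance to a subspace is the quotient seminorm, hence sublinear.
\<close>

lemma infdist_subspace_add_le:
  fixes G :: "'b::real_normed_vector set"
  assumes G: "subspace G"
  shows "infdist (x + y) G \<le> infdist x G + infdist y G"
proof (rule field_le_epsilon)
  fix e :: real assume e: "0 < e"
  have ne: "G \<noteq> {}" using subspace_0[OF G] by auto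
  obtain a where a: "a \<in> G" "dist x a < infdist x G + e / 2"
    using cInf_lessD[of "dist x ` G" "infdist x G + e/2"] ne e by (auto simp: infdist_notempty)
  obtain b where b: "b \<in> G" "dist y b < infdist y G + e / 2"
    using cInf_lessD[of "dist y ` G" "infdist y G + e/2"] ne e by (auto simp: infdist_notempty)
  have "infdist (x + y) G \<le> dist (x + y) (a + b)"
    using subspace_add[OF G a(1) b(1)] by (rule infdist_le)
  also have "\<dots> \<le> dist x a + dist y b"
    by (rule dist_triangle_add)
  finally show "infdist (x + y) G \<le> infdist x G + infdist y G + e"
    using a b by simp
qed

lemma infdist_subspace_scaleR:
  fixes G :: "'b::real_normed_vector set"
  assumes G: "subspace G" and r: "0 \<le> r"
  shows "infdist (r *\<^sub>R x) G = r * infdist x G"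
proof -
  have ne: "G \<noteq> {}" using subspace_0[OF G] by auto
  have le: "infdist (r *\<^sub>R x) G \<le> r * infdist x G" if "0 < r" for r x
  proof -
    have "infdist (r *\<^sub>R x) G / r \<le> dist x a" if a: "a \<in> G" for a
    proof -
      have "infdist (r *\<^sub>R x) G \<le> dist (r *\<^sub>R x) (r *\<^sub>R a)"
        using subspace_scale[OF G a] by (rule infdist_le)
      also have "\<dots> = r * dist x a"
        using \<open>0 < r\<close> by (simp add: dist_norm flip: scaleR_diff_right)
      finally show ?thesis using \<open>0 < r\<close> by (simp add: field_simps)
    qed
    then have "infdist (r *\<^sub>R x) G / r \<le> infdist x G"
      using ne by (auto simp: infdist_notempty intro!: cINF_greatest)
    then show ?thesis using \<open>0 < r\<close> by (simp add: field_simps)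
  qed
  show ?thesis
  proof (cases "r = 0")
    case True
    then show ?thesis using subspace_0[OF G] by simp
  next
    case False
    then have r: "0 < r" using r by simp
    have "r * infdist x G \<le> r * (inverse r * infdist (r *\<^sub>R x) G)"
      using le[of "inverse r" "r *\<^sub>R x"] r by (intro mult_left_mono) auto
    then show ?thesis using le[OF r, of x] r by (simp add: field_simps)
  qed
qed

text \<open>
  The distance of the integral to \<open>G\<close> is at most the integral of the distance, which vanishes. For
  an approximating simple function \<open>s\<^sub>i\<close>, whose values need not lie in \<open>G\<close>, the integral of its
  distance is bounded by that of \<open>norm (f x - s\<^sub>i x)\<close>, since \<open>f x\<close> is a point of \<open>G\<close>.
\<close>

lemma integral_in_closed_subspace:
  fixes f :: "'a \<Rightarrow> 'b::{banach, second_countable_topology}"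
  assumes G: "subspace G" "closed G" and f: "integrable M f" and fG: "AE x in M. f x \<in> G"
  shows "integral\<^sup>L M f \<in> G"
proof -
  let ?q = "\<lambda>y. infdist y G"
  have ne: "G \<noteq> {}" using subspace_0[OF G(1)] by auto
  have [measurable]: "?q \<in> borel_measurable borel"
    by (intro borel_measurable_continuous_onI continuous_intros)
  obtain s where s: "\<And>i. Bochner_Integration.simple_bochner_integrable M (s i)"
      and s_lim: "(\<lambda>i. \<integral>\<^sup>+x. norm (f x - s i x) \<partial>M) \<longlonglongrightarrow> 0"
      and s_int: "(\<lambda>i. Bochner_Integration.simple_bochner_integral M (s i)) \<longlonglongrightarrow> integral\<^sup>L M f"
    using has_bochner_integral_integrable[OF f] by (rule has_bochner_integral.cases) (rule that)
  have bound: "ennreal (?q (Bochner_Integration.simple_bochner_integral M (s i))) \<le> (\<integral>\<^sup>+x. norm (f x - s i x) \<partial>M)" for i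
  proof -
    have sq: "Bochner_Integration.simple_bochner_integrable M (\<lambda>x. ?q (s i x))"
      using simple_bochner_integrable_compose2[where p="\<lambda>x y. ?q x", OF _ s s] subspace_0[OF G(1)]
      by simp
    have "?q (Bochner_Integration.simple_bochner_integral M (s i)) \<le> Bochner_Integration.simple_bochner_integral M (\<lambda>x. ?q (s i x))"
      using s infdist_subspace_add_le[OF G(1)] infdist_subspace_scaleR[OF G(1)]
      by (rule simple_bochner_integral_sublinear_le)
    then have "ennreal (?q (Bochner_Integration.simple_bochner_integral M (s i)))
        \<le> ennreal (Bochner_Integration.simple_bochner_integral M (\<lambda>x. ?q (s i x)))"
      by (rule ennreal_leI)
    also have "\<dots> = (\<integral>\<^sup>+x. ?q (s i x) \<partial>M)"
      using sq by (rule simple_bochner_integral_eq_nn_integral) (simp add: infdist_nonneg)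
    also have "\<dots> \<le> (\<integral>\<^sup>+x. norm (f x - s i x) \<partial>M)"
    proof (rule nn_integral_mono_AE, use fG in eventually_elim)
      fix x assume "f x \<in> G"
      then show "ennreal (?q (s i x)) \<le> ennreal (norm (f x - s i x))"
        using infdist_le[of "f x" G "s i x"]
        by (simp add: dist_norm norm_minus_commute ennreal_leI)
    qed
    finally show ?thesis .
  qed
  have "(\<lambda>i. ennreal (?q (Bochner_Integration.simple_bochner_integral M (s i)))) \<longlonglongrightarrow> 0"
    by (rule tendsto_sandwich[OF _ _ tendsto_const s_lim]) (auto simp: bound)
  moreover have "(\<lambda>i. ennreal (?q (Bochner_Integration.simple_bochner_integral M (s i)))) \<longlonglongrightarrow> ennreal (?q (integral\<^sup>L M f))"
    using s_int by (intro tendsto_ennrealI tendsto_infdist)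
  ultimately have "ennreal (?q (integral\<^sup>L M f)) = 0"
    by (rule LIMSEQ_unique[rotated])
  then have "?q (integral\<^sup>L M f) = 0"
    using infdist_nonneg[of "integral\<^sup>L M f" G] by (simp add: ennreal_eq_0_iff)
  then show ?thesis
    using in_closed_iff_infdist_zero[OF G(2) ne] by simp
qed

text \<open>
  An unbounded operator, known through its graph, viewed over the reals.
\<close>

locale closed_operator =
  fixes A :: "'h::{banach,second_countable_topology} \<Rightarrow> 'h" and D :: "'h set"
  assumes subspace_graph: "subspace ((\<lambda>x. (x, A x)) ` D)"
    and closed_graph: "closed ((\<lambda>x. (x, A x)) ` D)"
begin

lemma in_graph_iff: "(x, y) \<in> (\<lambda>x. (x, A x)) ` D \<longleftrightarrow> x \<in> D \<and> A x = y"
  by auto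

lemma zero: "0 \<in> D" "A 0 = 0"
  using subspace_0[OF subspace_graph] by (auto simp: zero_prod_def in_graph_iff)

lemma limit:
  assumes "\<And>n. X n \<in> D" "X \<longlonglongrightarrow> x" "(\<lambda>n. A (X n)) \<longlonglongrightarrow> y"
  shows "x \<in> D" "A x = y"
proof -
  have "(x, y) \<in> (\<lambda>x. (x, A x)) ` D"
    using closed_graph by (rule closed_sequentially[of _ "\<lambda>n. (X n, A (X n))"]) (use assms in \<open>auto intro: tendsto_Pair\<close>)
  then show "x \<in> D" "A x = y" by (auto simp: in_graph_iff)
qed

text \<open>
  Hille's theorem: \<open>(f, h)\<close> takes values in the graph, a closed subspace, and so does its integral.
\<close>

lemma integral:
  assumes f: "integrable M f" and h: "integrable M h" and ae: "AE s in M. f s \<in> D \<and> A (f s) = h s"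
  shows "integral\<^sup>L M f \<in> D" "A (integral\<^sup>L M f) = integral\<^sup>L M h"
proof -
  have int: "integrable M (\<lambda>s. (f s, h s))"
  proof (rule Bochner_Integration.integrable_bound)
    show "integrable M (\<lambda>s. norm (f s) + norm (h s))" using f h by auto
    show "(\<lambda>s. (f s, h s)) \<in> borel_measurable M" using f h by measurable
    show "AE s in M. norm (f s, h s) \<le> norm (norm (f s) + norm (h s))"
      by (simp add: norm_Pair_le)
  qed
  have "integral\<^sup>L M (\<lambda>s. (f s, h s)) \<in> (\<lambda>x. (x, A x)) ` D"
    using subspace_graph closed_graph int by (rule integral_in_closed_subspace) (use ae in \<open>simp add: in_graph_iff\<close>)
  moreover have "integral\<^sup>L M (\<lambda>s. (f s, h s)) = (integral\<^sup>L M f, integral\<^sup>L M h)"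
    using integral_fst[OF int] integral_snd[OF int] by (simp add: prod_eq_iff)
  ultimately show "integral\<^sup>L M f \<in> D" "A (integral\<^sup>L M f) = integral\<^sup>L M h"
    by (auto simp: in_graph_iff)
qed

end

section \<open>Convolution\<close>

text \<open>
  Norms of causal functions take part in Tonelli arguments, so their local integrability is expressed
  with the extended nonnegative integral.
\<close>

definition causal_density :: "(real \<Rightarrow> ennreal) \<Rightarrow> bool" where
  "causal_density m \<longleftrightarrow> m \<in> borel_measurable borel \<and> (\<forall>t<0. m t = 0) \<and>
     (\<forall>T. (\<integral>\<^sup>+t. m t * indicator {..T} t \<partial>lborel) < \<infinity>)"

definition causal_signal :: "(real \<Rightarrow> 'a::{banach,second_countable_topology}) \<Rightarrow> bool" where
  "causal_signal h \<longleftrightarrow> h \<in> borel_measurable borel \<and> causal_density (\<lambda>t. ennreal (norm (h t)))"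

text \<open>
  An operator family is only strongly measurable, because the space of bounded operators is not
  separable in its norm. The majorant carries the integrability of the operator norm in a form that
  is Borel measurable by construction.
\<close>

definition causal_kernel ::
  "(real \<Rightarrow> 'a::{banach,second_countable_topology} \<Rightarrow>\<^sub>L 'b::{banach,second_countable_topology}) \<Rightarrow> bool" where
  "causal_kernel P \<longleftrightarrow> (\<forall>x. (\<lambda>t. blinfun_apply (P t) x) \<in> borel_measurable borel) \<and>
     (\<exists>p. causal_density p \<and> (\<forall>t. ennreal (norm (P t)) \<le> p t))"

definition line_convol ::
  "(real \<Rightarrow> 'a::{banach,second_countable_topology} \<Rightarrow>\<^sub>L 'b::{banach,second_countable_topology}) \<Rightarrow>
    (real \<Rightarrow> 'a) \<Rightarrow> real \<Rightarrow> 'b" (infixl "\<star>" 75) where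
  "(P \<star> h) t = (LINT s|lborel. blinfun_apply (P (t - s)) (h s))"

lemma AE_reflect:
  assumes "AE t in lborel. Q t"
  shows "AE s in lborel. Q (t - s :: real)"
proof -
  obtain N where N: "{x \<in> space lborel. \<not> Q x} \<subseteq> N" "emeasure lborel N = 0" "N \<in> sets lborel"
    using assms by (rule AE_E)
  have "AE s in lborel. t + (-1) * s \<notin> N"
    using N by (intro AE_borel_affine) (auto intro!: AE_not_in null_setsI)
  then have "AE s in lborel. t - s \<notin> N" by simp
  then show ?thesis by eventually_elim (use N(1) in auto)
qed

lemma causal_density_bound:
  assumes m: "causal_density m" and n: "n \<in> borel_measurable borel" "\<And>t. n t \<le> m t"
  shows "causal_density n"
proof -
  have "(\<integral>\<^sup>+t. n t * indicator {..T} t \<partial>lborel) \<le> (\<integral>\<^sup>+t. m t * indicator {..T} t \<partial>lborel)" for T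
    by (intro nn_integral_mono mult_right_mono n) auto
  moreover have "n t = 0" if "t < 0" for t
    using m n(2)[of t] that by (simp add: causal_density_def)
  ultimately show ?thesis
    using m n(1) unfolding causal_density_def by (meson le_less_trans)
qed

lemma causal_density_AE:
  assumes m: "causal_density m"
  shows "AE t in lborel. m t < \<infinity>"
proof -
  have [measurable]: "m \<in> borel_measurable borel" using m by (simp add: causal_density_def)
  have "AE t in lborel. m t * indicator {..real n} t \<noteq> \<infinity>" for n
    using m by (intro nn_integral_PInf_AE) (auto simp: causal_density_def less_top)
  then have "AE t in lborel. \<forall>n. m t * indicator {..real n} t \<noteq> \<infinity>"
    by (simp add: AE_all_countable)
  then show ?thesis
  proof eventually_elim
    fix t assume *: "\<forall>n. m t * indicator {..real n} t \<noteq> \<infinity>"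
    obtain n where "t \<le> real n" using real_arch_simple by blast
    with *[rule_format, of n] show "m t < \<infinity>" by (simp add: less_top)
  qed
qed

text \<open>
  Young's inequality on the window \<open>{..T}\<close>: by causality only the values of \<open>p\<close> and \<open>m\<close> on \<open>{0..T}\<close>
  enter for \<open>t \<le> T\<close>, so both may be truncated and the double integral factorises after exchanging the order.
\<close>

lemma causal_density_convolution:
  assumes p: "causal_density p" and m: "causal_density m"
  shows "causal_density (\<lambda>t. \<integral>\<^sup>+s. p (t - s) * m s \<partial>lborel)"
proof -
  have [measurable]: "p \<in> borel_measurable borel" "m \<in> borel_measurable borel"
    and p0: "\<And>t. t < 0 \<Longrightarrow> p t = 0" and m0: "\<And>t. t < 0 \<Longrightarrow> m t = 0"
    using p m by (auto simp: causal_density_def)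
  have meas: "(\<lambda>t. \<integral>\<^sup>+s. p (t - s) * m s \<partial>lborel) \<in> borel_measurable borel"
    by measurable
  moreover have "(\<integral>\<^sup>+s. p (t - s) * m s \<partial>lborel) = 0" if "t < 0" for t
  proof -
    have "p (t - s) * m s = 0" for s
      using that p0[of "t - s"] m0[of s] by (cases "s < 0") auto
    then have "(\<lambda>s. p (t - s) * m s) = (\<lambda>_. 0)" by blast
    then show ?thesis by simp
  qed
  moreover have "(\<integral>\<^sup>+t. (\<integral>\<^sup>+s. p (t - s) * m s \<partial>lborel) * indicator {..T} t \<partial>lborel) < \<infinity>" for T
  proof -
    define p1 where "p1 t = p t * indicator {..T} t" for t
    define m1 where "m1 t = m t * indicator {..T} t" for t
    have [measurable]: "p1 \<in> borel_measurable borel" "m1 \<in> borel_measurable borel"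
      unfolding p1_def m1_def by measurable
    \<comment> \<open>For \<open>t \<le> T\<close> the integrand vanishes unless \<open>0 \<le> s \<le> t\<close>, and then both arguments are at most \<open>T\<close>.\<close>
    have trunc: "p (t - s) * m s * indicator {..T} t \<le> p1 (t - s) * m1 s" for t s
      using p0[of "t - s"] m0[of s]
      by (cases "s < 0"; cases "t < s") (auto simp: p1_def m1_def split: split_indicator)
    have "(\<integral>\<^sup>+t. (\<integral>\<^sup>+s. p (t - s) * m s \<partial>lborel) * indicator {..T} t \<partial>lborel)
        = (\<integral>\<^sup>+t. \<integral>\<^sup>+s. p (t - s) * m s * indicator {..T} t \<partial>lborel \<partial>lborel)"
      by (subst nn_integral_multc) auto
    also have "\<dots> \<le> (\<integral>\<^sup>+t. \<integral>\<^sup>+s. p1 (t - s) * m1 s \<partial>lborel \<partial>lborel)"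
      by (intro nn_integral_mono trunc)
    also have "\<dots> = (\<integral>\<^sup>+s. \<integral>\<^sup>+t. p1 (t - s) * m1 s \<partial>lborel \<partial>lborel)"
      by (rule lborel_pair.Fubini') measurable
    also have "\<dots> = (\<integral>\<^sup>+s. (\<integral>\<^sup>+t. p1 t \<partial>lborel) * m1 s \<partial>lborel)"
    proof (rule nn_integral_cong)
      fix s
      have "(\<integral>\<^sup>+t. p1 t \<partial>lborel) = (\<integral>\<^sup>+t. p1 (t - s) \<partial>lborel)"
        using nn_integral_real_affine[of p1 1 "- s"] by simp
      then show "(\<integral>\<^sup>+t. p1 (t - s) * m1 s \<partial>lborel) = (\<integral>\<^sup>+t. p1 t \<partial>lborel) * m1 s"
        by (simp add: nn_integral_multc)
    qed
    also have "\<dots> = (\<integral>\<^sup>+t. p1 t \<partial>lborel) * (\<integral>\<^sup>+s. m1 s \<partial>lborel)"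
      by (rule nn_integral_cmult) measurable
    also have "\<dots> < \<infinity>"
      using p m by (auto simp: causal_density_def p1_def m1_def ennreal_mult_less_top)
    finally show ?thesis .
  qed
  ultimately show ?thesis by (simp add: causal_density_def)
qed

lemma causal_signal_bound:
  assumes f: "causal_signal f" and g: "causal_signal g"
    and h: "h \<in> borel_measurable borel" "\<And>t. norm (h t) \<le> norm (f t) + norm (g t)"
  shows "causal_signal h"
proof -
  have [measurable]: "f \<in> borel_measurable borel" "g \<in> borel_measurable borel"
    using f g by (auto simp: causal_signal_def)
  have "causal_density (\<lambda>t. ennreal (norm (f t)) + ennreal (norm (g t)))"
    using f g by (auto simp: causal_signal_def causal_density_def distrib_right nn_integral_add)
  then have "causal_density (\<lambda>t. ennreal (norm (h t)))"
    by (rule causal_density_bound) (use h in \<open>auto simp flip: ennreal_plus intro: ennreal_leI\<close>)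
  then show ?thesis using h(1) by (simp add: causal_signal_def)
qed

lemma causal_signal_diff:
  assumes "causal_signal f" "causal_signal g"
  shows "causal_signal (\<lambda>t. f t - g t)"
  using assms
  by (rule causal_signal_bound) (use assms in \<open>auto simp: causal_signal_def norm_triangle_ineq4\<close>)

lemma causal_signal_add:
  assumes "causal_signal f" "causal_signal g"
  shows "causal_signal (\<lambda>t. f t + g t)"
  using assms
  by (rule causal_signal_bound) (use assms in \<open>auto simp: causal_signal_def norm_triangle_ineq\<close>)

lemma causal_signal_negative: "causal_signal h \<Longrightarrow> t < 0 \<Longrightarrow> h t = 0"
  by (auto simp: causal_signal_def causal_density_def)

lemma causal_kernel_negative:
  assumes "causal_kernel P" "t < 0"
  shows "P t = 0"
proof -
  obtain p where "causal_density p" "\<And>t. ennreal (norm (P t)) \<le> p t"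
    using assms(1) by (auto simp: causal_kernel_def)
  then show ?thesis
    using assms(2) by (metis ennreal_eq_0_iff le_zero_eq causal_density_def norm_le_zero_iff)
qed

text \<open>
  \<open>(t, x) \<mapsto> P t x\<close> is a Caratheodory function: Borel in \<open>t\<close> and continuous in \<open>x\<close>. Approximating
  \<open>g\<close> by simple functions reduces the claim to constant second arguments.
\<close>

lemma causal_kernel_apply_measurable:
  assumes P: "causal_kernel P"
    and [measurable]: "f \<in> borel_measurable M" "g \<in> borel_measurable M"
  shows "(\<lambda>z. blinfun_apply (P (f z)) (g z)) \<in> borel_measurable M"
proof -
  have [measurable]: "(\<lambda>t. blinfun_apply (P t) x) \<in> borel_measurable borel" for x
    using P by (simp add: causal_kernel_def)
  obtain G where G: "\<And>i. simple_function M (G i)"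
      and G_lim: "\<And>z. z \<in> space M \<Longrightarrow> (\<lambda>i. G i z) \<longlonglongrightarrow> g z"
    using borel_measurable_implies_sequence_metric[of g M 0] by auto
  show ?thesis
  proof (rule borel_measurable_LIMSEQ_metric)
    show "(\<lambda>i. blinfun_apply (P (f z)) (G i z)) \<longlonglongrightarrow> blinfun_apply (P (f z)) (g z)"
      if "z \<in> space M" for z
      using G_lim[OF that] by (intro tendsto_intros)
    show "(\<lambda>z. blinfun_apply (P (f z)) (G i z)) \<in> borel_measurable M" for i
    proof (rule measurable_compose_countable'[where f="\<lambda>y z. blinfun_apply (P (f z)) y" and g="G i" and I="G i ` space M"])
      show "G i \<in> measurable M (count_space (G i ` space M))"
        using G[of i] by (auto simp: simple_function_def measurable_count_space_eq2)
      show "countable (G i ` space M)"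
        using G[of i] by (auto simp: simple_function_def intro: countable_finite)
    qed measurable
  qed
qed

lemma ennreal_norm_blinfun_apply_le:
  assumes "ennreal (norm P) \<le> p"
  shows "ennreal (norm (blinfun_apply P x)) \<le> p * ennreal (norm x)"
proof -
  have "ennreal (norm (blinfun_apply P x)) \<le> ennreal (norm P * norm x)"
    by (intro ennreal_leI norm_blinfun)
  also have "\<dots> \<le> p * ennreal (norm x)"
    by (simp add: ennreal_mult mult_right_mono assms)
  finally show ?thesis .
qed

lemma convolution_AE_integrable:
  assumes P: "causal_kernel P" and h: "causal_signal h"
  shows "AE t in lborel. integrable lborel (\<lambda>s. blinfun_apply (P (t - s)) (h s))"
proof -
  have [measurable]: "h \<in> borel_measurable borel" using h by (simp add: causal_signal_def)
  obtain p where p: "causal_density p" "\<And>t. ennreal (norm (P t)) \<le> p t"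
    using P by (auto simp: causal_kernel_def)
  have "AE t in lborel. (\<integral>\<^sup>+s. p (t - s) * ennreal (norm (h s)) \<partial>lborel) < \<infinity>"
    using p h by (intro causal_density_AE causal_density_convolution) (auto simp: causal_signal_def)
  then show ?thesis
  proof eventually_elim
    fix t assume fin: "(\<integral>\<^sup>+s. p (t - s) * ennreal (norm (h s)) \<partial>lborel) < \<infinity>"
    show "integrable lborel (\<lambda>s. blinfun_apply (P (t - s)) (h s))"
    proof (rule integrableI_bounded)
      show "(\<lambda>s. blinfun_apply (P (t - s)) (h s)) \<in> borel_measurable lborel"
        by (intro causal_kernel_apply_measurable[OF P]) measurable
      have "(\<integral>\<^sup>+s. ennreal (norm (blinfun_apply (P (t - s)) (h s))) \<partial>lborel)
          \<le> (\<integral>\<^sup>+s. p (t - s) * ennreal (norm (h s)) \<partial>lborel)"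
        by (intro nn_integral_mono ennreal_norm_blinfun_apply_le p)
      then show "(\<integral>\<^sup>+s. ennreal (norm (blinfun_apply (P (t - s)) (h s))) \<partial>lborel) < \<infinity>"
        using fin by simp
    qed
  qed
qed

text \<open>
  The convolution is defined at every point: where its integrand fails to be integrable, it is zero
  and satisfies the bound by the convolution of the majorants trivially.
\<close>

lemma causal_signal_convolution:
  assumes P: "causal_kernel P" and h: "causal_signal h"
  shows "causal_signal (P \<star> h)"
proof -
  have [measurable]: "h \<in> borel_measurable borel" using h by (simp add: causal_signal_def)
  obtain p where p: "causal_density p" "\<And>t. ennreal (norm (P t)) \<le> p t"
    using P by (auto simp: causal_kernel_def)
  have joint: "(\<lambda>(t, s). blinfun_apply (P (t - s)) (h s)) \<in> borel_measurable (borel \<Otimes>\<^sub>M lborel)"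
    unfolding case_prod_beta by (intro causal_kernel_apply_measurable[OF P]) measurable
  have meas: "(P \<star> h) \<in> borel_measurable borel"
    unfolding line_convol_def[abs_def] using joint by (rule lborel.borel_measurable_lebesgue_integral)
  have "causal_density (\<lambda>t. \<integral>\<^sup>+s. p (t - s) * ennreal (norm (h s)) \<partial>lborel)"
    using p h by (intro causal_density_convolution) (auto simp: causal_signal_def)
  moreover have "ennreal (norm ((P \<star> h) t)) \<le> (\<integral>\<^sup>+s. p (t - s) * ennreal (norm (h s)) \<partial>lborel)" for t
  proof (cases "integrable lborel (\<lambda>s. blinfun_apply (P (t - s)) (h s))")
    case True
    then have "ennreal (norm ((P \<star> h) t)) \<le> (\<integral>\<^sup>+s. norm (blinfun_apply (P (t - s)) (h s)) \<partial>lborel)"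
      unfolding line_convol_def by (rule integral_norm_bound_ennreal)
    also have "\<dots> \<le> (\<integral>\<^sup>+s. p (t - s) * ennreal (norm (h s)) \<partial>lborel)"
      by (intro nn_integral_mono ennreal_norm_blinfun_apply_le p)
    finally show ?thesis .
  next
    case False
    then show ?thesis by (simp add: line_convol_def not_integrable_integral_eq)
  qed
  ultimately have "causal_density (\<lambda>t. ennreal (norm ((P \<star> h) t)))"
    using meas by - (rule causal_density_bound, auto)
  then show ?thesis using meas by (simp add: causal_signal_def)
qed

lemma causal_signal_kernel_apply:
  assumes P: "causal_kernel P"
  shows "causal_signal (\<lambda>t. blinfun_apply (P t) x)"
proof -
  obtain p where p: "causal_density p" "\<And>t. ennreal (norm (P t)) \<le> p t"
    using P by (auto simp: causal_kernel_def)
  have meas: "(\<lambda>t. blinfun_apply (P t) x) \<in> borel_measurable borel"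
    using P by (simp add: causal_kernel_def)
  have "causal_density (\<lambda>t. p t * ennreal (norm x))"
    using p(1) by (auto simp: causal_density_def mult.commute[of _ "ennreal (norm x)"] mult.assoc
      nn_integral_cmult ennreal_mult_less_top)
  then have "causal_density (\<lambda>t. ennreal (norm (blinfun_apply (P t) x)))"
    by (rule causal_density_bound) (use meas p(2) in \<open>auto intro: ennreal_norm_blinfun_apply_le\<close>)
  with meas show ?thesis by (simp add: causal_signal_def)
qed

lemma convolution_cong_AE:
  assumes P: "causal_kernel P" and "f \<in> borel_measurable borel" "g \<in> borel_measurable borel"
    and ae: "AE t in lborel. f t = g t"
  shows "(P \<star> f) t = (P \<star> g) t"
  unfolding line_convol_def using assms(2,3)
  by (intro integral_cong_AE causal_kernel_apply_measurable[OF P]) (use ae in auto)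

lemma convolution_diff:
  assumes "causal_kernel P" "causal_signal f" "causal_signal g"
  shows "AE t in lborel. (P \<star> (\<lambda>s. f s - g s)) t = (P \<star> f) t - (P \<star> g) t"
  using convolution_AE_integrable[OF assms(1,2)] convolution_AE_integrable[OF assms(1,3)]
  by eventually_elim (simp add: line_convol_def blinfun.diff_right)

text \<open>
  The exceptional null set does not depend on \<open>x\<close>: it consists of the points where the convolution of
  the two majorants is infinite, and \<open>C\<close> is the value of that convolution.
\<close>

lemma convolution_kernels_AE_integrable:
  assumes P: "causal_kernel P" and Q: "causal_kernel Q"
  shows "AE t in lborel. \<exists>C\<ge>0. \<forall>x. integrable lborel (\<lambda>s. blinfun_apply (P (t - s)) (blinfun_apply (Q s) x))
     \<and> norm (LINT s|lborel. blinfun_apply (P (t - s)) (blinfun_apply (Q s) x)) \<le> C * norm x"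
proof -
  obtain p where p: "causal_density p" "\<And>t. ennreal (norm (P t)) \<le> p t"
    using P by (auto simp: causal_kernel_def)
  obtain q where q: "causal_density q" "\<And>t. ennreal (norm (Q t)) \<le> q t"
    using Q by (auto simp: causal_kernel_def)
  have [measurable]: "p \<in> borel_measurable borel" "q \<in> borel_measurable borel"
    using p q by (auto simp: causal_density_def)
  have [measurable]: "(\<lambda>s. blinfun_apply (Q s) x) \<in> borel_measurable borel" for x
    using Q by (simp add: causal_kernel_def)
  have "AE t in lborel. (\<integral>\<^sup>+s. p (t - s) * q s \<partial>lborel) < \<infinity>"
    using p q by (intro causal_density_AE causal_density_convolution)
  then show ?thesis
  proof eventually_elim
    fix t assume fin: "(\<integral>\<^sup>+s. p (t - s) * q s \<partial>lborel) < \<infinity>"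
    define C where "C = enn2real (\<integral>\<^sup>+s. p (t - s) * q s \<partial>lborel)"
    have C: "ennreal C = (\<integral>\<^sup>+s. p (t - s) * q s \<partial>lborel)" "0 \<le> C"
      using fin by (auto simp: C_def)
    have *: "integrable lborel (\<lambda>s. blinfun_apply (P (t - s)) (blinfun_apply (Q s) x))
        \<and> norm (LINT s|lborel. blinfun_apply (P (t - s)) (blinfun_apply (Q s) x)) \<le> C * norm x" for x
    proof
      have "(\<integral>\<^sup>+s. norm (blinfun_apply (P (t - s)) (blinfun_apply (Q s) x)) \<partial>lborel)
          \<le> (\<integral>\<^sup>+s. p (t - s) * q s * ennreal (norm x) \<partial>lborel)"
      proof (rule nn_integral_mono)
        fix s
        have "ennreal (norm (blinfun_apply (P (t - s)) (blinfun_apply (Q s) x)))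
            \<le> p (t - s) * ennreal (norm (blinfun_apply (Q s) x))"
          by (intro ennreal_norm_blinfun_apply_le p)
        also have "\<dots> \<le> p (t - s) * (q s * ennreal (norm x))"
          by (intro mult_left_mono ennreal_norm_blinfun_apply_le q) simp
        finally show "ennreal (norm (blinfun_apply (P (t - s)) (blinfun_apply (Q s) x)))
            \<le> p (t - s) * q s * ennreal (norm x)" by (simp add: mult.assoc)
      qed
      also have "\<dots> = ennreal (C * norm x)"
        by (subst nn_integral_multc) (auto simp: C(1)[symmetric] ennreal_mult C(2))
      finally have le: "(\<integral>\<^sup>+s. norm (blinfun_apply (P (t - s)) (blinfun_apply (Q s) x)) \<partial>lborel)
          \<le> ennreal (C * norm x)" .
      show int: "integrable lborel (\<lambda>s. blinfun_apply (P (t - s)) (blinfun_apply (Q s) x))"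
      proof (rule integrableI_bounded)
        show "(\<lambda>s. blinfun_apply (P (t - s)) (blinfun_apply (Q s) x)) \<in> borel_measurable lborel"
          by (intro causal_kernel_apply_measurable[OF P]) measurable
      qed (use le in \<open>auto intro: le_less_trans\<close>)
      show "norm (LINT s|lborel. blinfun_apply (P (t - s)) (blinfun_apply (Q s) x)) \<le> C * norm x"
        using order_trans[OF integral_norm_bound_ennreal[OF int] le] C(2) by (simp add: ennreal_le_iff)
    qed
    show "\<exists>C\<ge>0. \<forall>x. integrable lborel (\<lambda>s. blinfun_apply (P (t - s)) (blinfun_apply (Q s) x))
        \<and> norm (LINT s|lborel. blinfun_apply (P (t - s)) (blinfun_apply (Q s) x)) \<le> C * norm x"
      using * C(2) by blast
  qed
qed

text \<open>
  Fubini's theorem for \<open>P (t - r) (Q (r - s) (h s))\<close>, integrable in \<open>(r, s)\<close> wherever the triple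
  convolution of the majorants is finite. The inner integral on the right is the kernel \<open>P * Q\<close> at
  \<open>t - s\<close>, applied to \<open>h s\<close>; its integrability in \<open>s\<close> is part of the conclusion because it
  is needed to integrate pointwise statements about \<open>P * Q\<close>.
\<close>

lemma convolution_assoc:
  assumes P: "causal_kernel P" and Q: "causal_kernel Q" and h: "causal_signal h"
  shows "AE t in lborel.
     integrable lborel (\<lambda>s. LINT r|lborel. blinfun_apply (P (t - s - r)) (blinfun_apply (Q r) (h s))) \<and>
     (P \<star> (Q \<star> h)) t
       = (LINT s|lborel. LINT r|lborel. blinfun_apply (P (t - s - r)) (blinfun_apply (Q r) (h s)))"
proof -
  have [measurable]: "h \<in> borel_measurable borel" using h by (simp add: causal_signal_def)
  obtain p where p: "causal_density p" "\<And>t. ennreal (norm (P t)) \<le> p t"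
    using P by (auto simp: causal_kernel_def)
  obtain q where q: "causal_density q" "\<And>t. ennreal (norm (Q t)) \<le> q t"
    using Q by (auto simp: causal_kernel_def)
  have [measurable]: "p \<in> borel_measurable borel" "q \<in> borel_measurable borel"
    using p q by (auto simp: causal_density_def)
  have "AE t in lborel. (\<integral>\<^sup>+r. p (t - r) * (\<integral>\<^sup>+s. q (r - s) * ennreal (norm (h s)) \<partial>lborel) \<partial>lborel) < \<infinity>"
    using p q h by (intro causal_density_AE causal_density_convolution) (auto simp: causal_signal_def)
  then show ?thesis
  proof eventually_elim
    fix t assume fin: "(\<integral>\<^sup>+r. p (t - r) * (\<integral>\<^sup>+s. q (r - s) * ennreal (norm (h s)) \<partial>lborel) \<partial>lborel) < \<infinity>"
    define F where "F r s = blinfun_apply (P (t - r)) (blinfun_apply (Q (r - s)) (h s))" for r s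
    have F_meas [measurable]: "case_prod F \<in> borel_measurable (lborel \<Otimes>\<^sub>M lborel)"
      unfolding F_def case_prod_beta
      by (intro causal_kernel_apply_measurable[OF P] causal_kernel_apply_measurable[OF Q]) measurable
    have F_bound: "ennreal (norm (F r s)) \<le> p (t - r) * (q (r - s) * ennreal (norm (h s)))" for r s
    proof -
      have "ennreal (norm (F r s)) \<le> p (t - r) * ennreal (norm (blinfun_apply (Q (r - s)) (h s)))"
        unfolding F_def by (intro ennreal_norm_blinfun_apply_le p)
      also have "\<dots> \<le> p (t - r) * (q (r - s) * ennreal (norm (h s)))"
        by (intro mult_left_mono ennreal_norm_blinfun_apply_le q) simp
      finally show ?thesis .
    qed
    have F_int: "integrable (lborel \<Otimes>\<^sub>M lborel) (case_prod F)"
    proof (rule integrableI_bounded)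
      have "(\<integral>\<^sup>+z. norm (case_prod F z) \<partial>(lborel \<Otimes>\<^sub>M lborel)) = (\<integral>\<^sup>+r. \<integral>\<^sup>+s. norm (F r s) \<partial>lborel \<partial>lborel)"
        by (subst lborel.nn_integral_fst[symmetric]) auto
      also have "\<dots> \<le> (\<integral>\<^sup>+r. \<integral>\<^sup>+s. p (t - r) * (q (r - s) * ennreal (norm (h s))) \<partial>lborel \<partial>lborel)"
        by (intro nn_integral_mono F_bound)
      also have "\<dots> = (\<integral>\<^sup>+r. p (t - r) * (\<integral>\<^sup>+s. q (r - s) * ennreal (norm (h s)) \<partial>lborel) \<partial>lborel)"
        by (intro nn_integral_cong nn_integral_cmult) measurable
      finally show "(\<integral>\<^sup>+z. norm (case_prod F z) \<partial>(lborel \<Otimes>\<^sub>M lborel)) < \<infinity>"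
        using fin by simp
    qed (rule F_meas)
    have shift: "(LINT r|lborel. F r s)
        = (LINT r|lborel. blinfun_apply (P (t - s - r)) (blinfun_apply (Q r) (h s)))" for s
      using lborel_integral_real_affine[of 1 "\<lambda>r. F r s" s] by (simp add: F_def algebra_simps)
    have "(P \<star> (Q \<star> h)) t = (LINT r|lborel. blinfun_apply (P (t - r)) (LINT s|lborel. blinfun_apply (Q (r - s)) (h s)))"
      by (simp add: line_convol_def)
    also have "\<dots> = (LINT r|lborel. LINT s|lborel. F r s)"
    proof (rule integral_cong_AE)
      have "(\<lambda>r. blinfun_apply (P (t - r)) ((Q \<star> h) r)) \<in> borel_measurable lborel"
        using causal_signal_convolution[OF Q h]
        by (intro causal_kernel_apply_measurable[OF P]) (auto simp: causal_signal_def)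
      then show "(\<lambda>r. blinfun_apply (P (t - r)) (LINT s|lborel. blinfun_apply (Q (r - s)) (h s))) \<in> borel_measurable lborel"
        by (simp add: line_convol_def)
      show "(\<lambda>r. LINT s|lborel. F r s) \<in> borel_measurable lborel"
        by measurable
      show "AE r in lborel. blinfun_apply (P (t - r)) (LINT s|lborel. blinfun_apply (Q (r - s)) (h s)) = (LINT s|lborel. F r s)"
        using convolution_AE_integrable[OF Q h]
        by eventually_elim (simp add: F_def integral_bounded_linear[OF blinfun.bounded_linear_right])
    qed
    also have "\<dots> = (LINT s|lborel. LINT r|lborel. F r s)"
      using lborel_pair.Fubini_integral[OF F_int] by simp
    finally show "integrable lborel (\<lambda>s. LINT r|lborel. blinfun_apply (P (t - s - r)) (blinfun_apply (Q r) (h s))) \<and>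
      (P \<star> (Q \<star> h)) t
        = (LINT s|lborel. LINT r|lborel. blinfun_apply (P (t - s - r)) (blinfun_apply (Q r) (h s)))"
      using lborel_pair.integrable_snd[OF F_int] by (simp add: shift)
  qed
qed

text \<open>
  The substitution \<open>r \<mapsto> t - s - r\<close> turns \<open>P * Q\<close> into \<open>Q * P\<close>.
\<close>

lemma convolution_commute:
  assumes P: "causal_kernel P" and Q: "causal_kernel Q" and h: "causal_signal h"
    and comm: "\<And>s t x. blinfun_apply (P s) (blinfun_apply (Q t) x) = blinfun_apply (Q t) (blinfun_apply (P s) x)"
  shows "AE t in lborel. (P \<star> (Q \<star> h)) t = (Q \<star> (P \<star> h)) t"
  using convolution_assoc[OF P Q h] convolution_assoc[OF Q P h]
proof eventually_elim
  fix t
  have "(LINT r|lborel. blinfun_apply (P (t - s - r)) (blinfun_apply (Q r) (h s)))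
      = (LINT r|lborel. blinfun_apply (Q (t - s - r)) (blinfun_apply (P r) (h s)))" for s
    using lborel_integral_real_affine[of "-1" "\<lambda>r. blinfun_apply (P (t - s - r)) (blinfun_apply (Q r) (h s))" "t - s"]
    by (simp add: comm)
  then show "integrable lborel (\<lambda>s. LINT r|lborel. blinfun_apply (P (t - s - r)) (blinfun_apply (Q r) (h s))) \<and>
     (P \<star> (Q \<star> h)) t
       = (LINT s|lborel. LINT r|lborel. blinfun_apply (P (t - s - r)) (blinfun_apply (Q r) (h s))) \<Longrightarrow>
     integrable lborel (\<lambda>s. LINT r|lborel. blinfun_apply (Q (t - s - r)) (blinfun_apply (P r) (h s))) \<and>
     (Q \<star> (P \<star> h)) t
       = (LINT s|lborel. LINT r|lborel. blinfun_apply (Q (t - s - r)) (blinfun_apply (P r) (h s))) \<Longrightarrow>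
     (P \<star> (Q \<star> h)) t = (Q \<star> (P \<star> h)) t"
    by simp
qed

section \<open>The resolvent identity under convolution\<close>

text \<open>
  The resolvent equation for causal representatives. \<open>K\<close> stands for multiplication by the scalar
  kernel, which enters through its commutation with \<open>E\<close> and with \<open>A\<close>.
\<close>

locale resolvent_pair = closed_operator A D
  for A :: "'h::{banach,second_countable_topology} \<Rightarrow> 'h" and D +
  fixes K E :: "real \<Rightarrow> 'h \<Rightarrow>\<^sub>L 'h"
  assumes dense: "closure D = UNIV"
    and K: "causal_kernel K" and E: "causal_kernel E"
    and comm: "blinfun_apply (K s) (blinfun_apply (E t) x) = blinfun_apply (E t) (blinfun_apply (K s) x)"
    and K_dom: "AE t in lborel. \<forall>x\<in>D.
      blinfun_apply (K t) x \<in> D \<and> A (blinfun_apply (K t) x) = blinfun_apply (K t) (A x)"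
    and E_dom: "AE t in lborel. \<forall>x\<in>D.
      blinfun_apply (E t) x \<in> D \<and> A (blinfun_apply (E t) x) = blinfun_apply (E t) (A x)"
    and resolvent: "AE t in lborel. \<forall>x\<in>D.
      blinfun_apply (E t) x = blinfun_apply (K t) x + (K \<star> (\<lambda>s. blinfun_apply (E s) (A x))) t"
begin

definition kE :: "real \<Rightarrow> 'h \<Rightarrow> 'h" where
  "kE t x = (LINT r|lborel. blinfun_apply (K (t - r)) (blinfun_apply (E r) x))"

text \<open>
  On \<open>D\<close>, both equalities come from Hille's theorem and the resolvent equation. In the first one
  the right-hand side is a bounded operator applied to \<open>x\<close>, so approximating an arbitrary \<open>x\<close> by
  elements of \<open>D\<close> and using that \<open>A\<close> is closed extends it to the whole space.
\<close>

lemma kE_resolvent: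
  "AE t in lborel.
     (\<forall>x. kE t x \<in> D \<and> A (kE t x) = blinfun_apply (E t) x - blinfun_apply (K t) x) \<and>
     (\<forall>x\<in>D. kE t (A x) = blinfun_apply (E t) x - blinfun_apply (K t) x)"
  using convolution_kernels_AE_integrable[OF K E] resolvent
proof eventually_elim
  fix t
  assume "\<exists>C\<ge>0. \<forall>x. integrable lborel (\<lambda>s. blinfun_apply (K (t - s)) (blinfun_apply (E s) x))
     \<and> norm (LINT s|lborel. blinfun_apply (K (t - s)) (blinfun_apply (E s) x)) \<le> C * norm x"
  then obtain C where int: "\<And>x. integrable lborel (\<lambda>s. blinfun_apply (K (t - s)) (blinfun_apply (E s) x))"
    and C: "\<And>x. norm (kE t x) \<le> C * norm x"
    by (auto simp: kE_def)
  assume "\<forall>x\<in>D. blinfun_apply (E t) x = blinfun_apply (K t) x + (K \<star> (\<lambda>s. blinfun_apply (E s) (A x))) t"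
  then have kE_A: "kE t (A x) = blinfun_apply (E t) x - blinfun_apply (K t) x" if "x \<in> D" for x
    using that by (simp add: kE_def line_convol_def)
  have kE_D: "kE t x \<in> D \<and> A (kE t x) = blinfun_apply (E t) x - blinfun_apply (K t) x" if x: "x \<in> D" for x
  proof -
    have "AE r in lborel. blinfun_apply (K (t - r)) (blinfun_apply (E r) x) \<in> D \<and>
        A (blinfun_apply (K (t - r)) (blinfun_apply (E r) x)) = blinfun_apply (K (t - r)) (blinfun_apply (E r) (A x))"
      using AE_reflect[OF K_dom, of t] E_dom by eventually_elim (use x in auto)
    then have "kE t x \<in> D" "A (kE t x) = kE t (A x)"
      unfolding kE_def using integral[OF int int] by auto
    with kE_A[OF x] show ?thesis by simp
  qed
  have "kE t x \<in> D \<and> A (kE t x) = blinfun_apply (E t) x - blinfun_apply (K t) x" for x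
  proof -
    have "x \<in> closure D" by (simp add: dense)
    then obtain X where X: "\<And>n. X n \<in> D" "X \<longlonglongrightarrow> x"
      by (auto simp: closure_sequential)
    have kE_diff: "kE t a - kE t b = kE t (a - b)" for a b
      by (simp add: kE_def blinfun.diff_right int)
    have "(\<lambda>n. kE t (X n)) \<longlonglongrightarrow> kE t x"
    proof (rule LIM_zero_cancel, rule Lim_null_comparison)
      show "\<forall>\<^sub>F n in sequentially. norm (kE t (X n) - kE t x) \<le> C * norm (X n - x)"
        by (simp add: kE_diff C)
      show "(\<lambda>n. C * norm (X n - x)) \<longlonglongrightarrow> 0"
        using X(2) by (intro tendsto_mult_right_zero tendsto_norm_zero LIM_zero)
    qed
    moreover have "(\<lambda>n. A (kE t (X n))) \<longlonglongrightarrow> blinfun_apply (E t) x - blinfun_apply (K t) x"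
      using kE_D X by (auto intro!: tendsto_intros)
    ultimately show ?thesis
      using limit[of "\<lambda>n. kE t (X n)"] kE_D X(1) by blast
  qed
  with kE_A show "(\<forall>x. kE t x \<in> D \<and> A (kE t x) = blinfun_apply (E t) x - blinfun_apply (K t) x) \<and>
     (\<forall>x\<in>D. kE t (A x) = blinfun_apply (E t) x - blinfun_apply (K t) x)"
    by blast
qed

text \<open>
  This smoothing property is the first equality of \<open>kE_resolvent\<close>, integrated by Hille's theorem.
  It holds for \<open>h\<close> with arbitrary values because that equality holds on the whole space.
\<close>

lemma twofold_convolution_in_domain:
  assumes h: "causal_signal h"
  shows "AE t in lborel. (K \<star> (E \<star> h)) t \<in> D \<and> A ((K \<star> (E \<star> h)) t) = (E \<star> h) t - (K \<star> h) t"
  using convolution_assoc[OF K E h] convolution_AE_integrable[OF K h] convolution_AE_integrable[OF E h]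
proof eventually_elim
  fix t
  assume assoc: "integrable lborel (\<lambda>s. LINT r|lborel. blinfun_apply (K (t - s - r)) (blinfun_apply (E r) (h s))) \<and>
      (K \<star> (E \<star> h)) t
        = (LINT s|lborel. LINT r|lborel. blinfun_apply (K (t - s - r)) (blinfun_apply (E r) (h s)))"
    and Kh: "integrable lborel (\<lambda>s. blinfun_apply (K (t - s)) (h s))"
    and Eh: "integrable lborel (\<lambda>s. blinfun_apply (E (t - s)) (h s))"
  have "AE s in lborel. kE (t - s) (h s) \<in> D \<and>
      A (kE (t - s) (h s)) = blinfun_apply (E (t - s)) (h s) - blinfun_apply (K (t - s)) (h s)"
    using AE_reflect[OF kE_resolvent, of t] by eventually_elim blast
  moreover have "integrable lborel (\<lambda>s. kE (t - s) (h s))" "(K \<star> (E \<star> h)) t = (LINT s|lborel. kE (t - s) (h s))"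
    using assoc by (auto simp: kE_def)
  ultimately show "(K \<star> (E \<star> h)) t \<in> D \<and> A ((K \<star> (E \<star> h)) t) = (E \<star> h) t - (K \<star> h) t"
    using integral[of lborel "\<lambda>s. kE (t - s) (h s)"
        "\<lambda>s. blinfun_apply (E (t - s)) (h s) - blinfun_apply (K (t - s)) (h s)"] Kh Eh
    by (simp add: line_convol_def)
qed

text \<open>
  The second equality of \<open>kE_resolvent\<close>, integrated against \<open>v\<close>.
\<close>

lemma twofold_convolution_of_image:
  assumes v: "causal_signal v" and w: "causal_signal w"
    and vw: "AE t in lborel. v t \<in> D \<and> A (v t) = w t"
  shows "AE t in lborel. (K \<star> (E \<star> w)) t = (E \<star> v) t - (K \<star> v) t"
  using convolution_assoc[OF K E w] convolution_AE_integrable[OF K v] convolution_AE_integrable[OF E v]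
proof eventually_elim
  fix t
  assume assoc: "integrable lborel (\<lambda>s. LINT r|lborel. blinfun_apply (K (t - s - r)) (blinfun_apply (E r) (w s))) \<and>
      (K \<star> (E \<star> w)) t
        = (LINT s|lborel. LINT r|lborel. blinfun_apply (K (t - s - r)) (blinfun_apply (E r) (w s)))"
    and Kv: "integrable lborel (\<lambda>s. blinfun_apply (K (t - s)) (v s))"
    and Ev: "integrable lborel (\<lambda>s. blinfun_apply (E (t - s)) (v s))"
  have ae: "AE s in lborel. kE (t - s) (w s) = blinfun_apply (E (t - s)) (v s) - blinfun_apply (K (t - s)) (v s)"
    using AE_reflect[OF kE_resolvent, of t] vw by eventually_elim auto
  have kE_w: "integrable lborel (\<lambda>s. kE (t - s) (w s))"
    and eq: "(K \<star> (E \<star> w)) t = (LINT s|lborel. kE (t - s) (w s))"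
    using assoc by (auto simp: kE_def)
  have "(K \<star> (E \<star> w)) t
      = (LINT s|lborel. blinfun_apply (E (t - s)) (v s) - blinfun_apply (K (t - s)) (v s))"
    unfolding eq by (rule integral_cong_AE[OF _ _ ae]) (use kE_w Kv Ev in simp_all)
  then show "(K \<star> (E \<star> w)) t = (E \<star> v) t - (K \<star> v) t"
    using Kv Ev by (simp add: line_convol_def)
qed

lemma scalar_convolution_in_domain:
  assumes v: "causal_signal v" and w: "causal_signal w"
    and vw: "AE t in lborel. v t \<in> D \<and> A (v t) = w t"
  shows "AE t in lborel. (K \<star> v) t \<in> D \<and> A ((K \<star> v) t) = (K \<star> w) t"
  using convolution_AE_integrable[OF K v] convolution_AE_integrable[OF K w]
proof eventually_elim
  fix t
  assume int: "integrable lborel (\<lambda>s. blinfun_apply (K (t - s)) (v s))"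
    "integrable lborel (\<lambda>s. blinfun_apply (K (t - s)) (w s))"
  have "AE s in lborel. blinfun_apply (K (t - s)) (v s) \<in> D \<and>
      A (blinfun_apply (K (t - s)) (v s)) = blinfun_apply (K (t - s)) (w s)"
    using AE_reflect[OF K_dom, of t] vw by eventually_elim auto
  then show "(K \<star> v) t \<in> D \<and> A ((K \<star> v) t) = (K \<star> w) t"
    using integral[OF int] by (simp add: line_convol_def)
qed

text \<open>
  From \<open>K * u = K * g + K * a\<close>, where \<open>K * a = A (K * E * g) = E * g - K * g\<close> by the smoothing property.
\<close>

lemma convolution_of_solution_formula:
  assumes g: "causal_signal g" and a: "causal_signal a" and u: "causal_signal u"
    and Eg: "AE t in lborel. (E \<star> g) t \<in> D \<and> A ((E \<star> g) t) = a t"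
    and u_eq: "AE t in lborel. u t = g t + a t"
  shows "AE t in lborel. (K \<star> u) t = (E \<star> g) t"
proof -
  have [measurable]: "g \<in> borel_measurable borel" "a \<in> borel_measurable borel" "u \<in> borel_measurable borel"
    using g a u by (auto simp: causal_signal_def)
  have ug: "AE t in lborel. u t - g t = a t"
    using u_eq by eventually_elim simp
  have "(K \<star> (\<lambda>s. u s - g s)) t = (K \<star> a) t" for t
    by (rule convolution_cong_AE[OF K _ _ ug]) measurable
  then have "AE t in lborel. (K \<star> a) t = (K \<star> u) t - (K \<star> g) t"
    using convolution_diff[OF K u g] by simp
  then show ?thesis
    using twofold_convolution_in_domain[OF g]
      scalar_convolution_in_domain[OF causal_signal_convolution[OF E g] a Eg]
    by eventually_elim simp
qed

text \<open>
  The resolvent identity first gives only \<open>K * (K * u) = K * (E * g)\<close>. Applying \<open>A\<close> to both sides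
  removes the outer \<open>K\<close>, because the images are \<open>K * u - K * g\<close> and \<open>E * g - K * g\<close>.
\<close>

lemma mild_solution_convolution:
  assumes u: "causal_signal u" and g: "causal_signal g"
    and sol: "AE t in lborel. (K \<star> u) t \<in> D \<and> A ((K \<star> u) t) = u t - g t"
  shows "AE t in lborel. (K \<star> u) t = (E \<star> g) t"
proof -
  let ?v = "K \<star> u" and ?w = "\<lambda>t. u t - g t"
  have v: "causal_signal ?v" and w: "causal_signal ?w"
    and Eu: "causal_signal (E \<star> u)" and Eg: "causal_signal (E \<star> g)" and Ew: "causal_signal (E \<star> ?w)"
    using causal_signal_convolution[OF K u] causal_signal_diff[OF u g] u g
      causal_signal_convolution[OF E] by blast+
  have [measurable]: "E \<star> u \<in> borel_measurable borel" "E \<star> g \<in> borel_measurable borel"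
      "E \<star> ?w \<in> borel_measurable borel"
    using Eu Eg Ew by (auto simp: causal_signal_def)
  have "(K \<star> (E \<star> ?w)) t = (K \<star> (\<lambda>s. (E \<star> u) s - (E \<star> g) s)) t" for t
    by (rule convolution_cong_AE[OF K _ _ convolution_diff[OF E u g]]) measurable
  then have "AE t in lborel. (K \<star> (E \<star> ?w)) t = (K \<star> (E \<star> u)) t - (K \<star> (E \<star> g)) t"
    using convolution_diff[OF K Eu Eg] by simp
  then have "AE t in lborel. (K \<star> ?v) t = (K \<star> (E \<star> g)) t"
    using twofold_convolution_of_image[OF v w sol] convolution_commute[OF K E u comm]
    by eventually_elim simp
  then show ?thesis
    using twofold_convolution_in_domain[OF g] scalar_convolution_in_domain[OF v w sol]
      convolution_diff[OF K u g]
    by eventually_elim simp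
qed

end

section \<open>Borel representatives\<close>

lemma AE_halfline_iff: "AE_halfline Q \<longleftrightarrow> (AE t in lborel. 0 \<le> t \<longrightarrow> Q t)"
  by (simp add: AE_halfline_def AE_completion_iff)

lemma borel_measurable_lebesgue_AE:
  fixes f h :: "real \<Rightarrow> 'a::topological_space"
  assumes h: "h \<in> borel_measurable borel" and ae: "AE t in lborel. f t = h t"
  shows "f \<in> borel_measurable lebesgue"
proof (rule measurableI)
  fix B :: "'a set" assume B: "B \<in> sets borel"
  show "f -` B \<inter> space lebesgue \<in> sets lebesgue"
  proof (rule completion.in_sets_AE)
    have "AE t in lborel. t \<in> h -` B \<longleftrightarrow> t \<in> f -` B \<inter> space lebesgue"
      using ae by eventually_elim simp
    then show "AE t in lebesgue. t \<in> h -` B \<longleftrightarrow> t \<in> f -` B \<inter> space lebesgue"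
      by (rule AE_completion)
    show "h -` B \<in> sets lebesgue"
      using measurable_sets[OF h B] by (simp add: sets_completionI_sets)
  qed auto
qed simp

lemma lebesgue_integral_borel_representative:
  fixes f :: "real \<Rightarrow> 'a::{banach,second_countable_topology}"
  assumes h: "h \<in> borel_measurable borel" and ae: "AE t in lborel. f t = h t"
  shows "integrable lebesgue f \<longleftrightarrow> integrable lborel h" "integral\<^sup>L lebesgue f = integral\<^sup>L lborel h"
proof -
  have meas: "f \<in> borel_measurable lebesgue" "h \<in> borel_measurable lebesgue"
    using borel_measurable_lebesgue_AE[OF h ae] h by (auto intro: measurable_completion)
  have ae': "AE t in lebesgue. f t = h t"
    using ae by (rule AE_completion)
  show "integrable lebesgue f \<longleftrightarrow> integrable lborel h"
    using integrable_cong_AE[OF meas ae'] h by (simp add: integrable_completion)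
  show "integral\<^sup>L lebesgue f = integral\<^sup>L lborel h"
    using integral_cong_AE[OF meas ae'] h by (simp add: integral_completion)
qed

text \<open>
  Each simple function of an approximating sequence agrees with a Borel simple function off a null
  set. Setting everything to zero on a common Borel null set makes the limit exist everywhere.
\<close>

lemma lebesgue_measurable_borel_representative:
  fixes f :: "real \<Rightarrow> 'a::{real_normed_vector,second_countable_topology}"
  assumes f: "f \<in> borel_measurable lebesgue"
  obtains h where "h \<in> borel_measurable borel" "AE t in lborel. f t = h t"
proof -
  obtain F where F: "\<And>i. simple_function lebesgue (F i)" "\<And>t. (\<lambda>i. F i t) \<longlonglongrightarrow> f t"
    using borel_measurable_implies_sequence_metric[OF f, of 0] by auto
  have "\<forall>i. \<exists>F'. simple_function lborel F' \<and> (AE t in lborel. F i t = F' t)"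
    using completion_ex_simple_function[OF F(1)] by blast
  then obtain F' where F': "\<And>i. simple_function lborel (F' i)" "\<And>i. AE t in lborel. F i t = F' i t"
    by metis
  have "AE t in lborel. \<forall>i. F i t = F' i t"
    using F'(2) by (simp add: AE_all_countable)
  then obtain N where N: "{t \<in> space lborel. \<not> (\<forall>i. F i t = F' i t)} \<subseteq> N"
      "emeasure lborel N = 0" "N \<in> sets lborel"
    by (rule AE_E)
  have [measurable]: "N \<in> sets borel" "\<And>i. F' i \<in> borel_measurable borel"
    using N(3) borel_measurable_simple_function[OF F'(1)] by auto
  let ?h = "\<lambda>t. if t \<in> N then 0 else f t"
  have "?h \<in> borel_measurable borel"
  proof (rule borel_measurable_LIMSEQ_metric)
    show "(\<lambda>t. if t \<in> N then 0 else F' i t) \<in> borel_measurable borel" for i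
      by measurable
    show "(\<lambda>i. if t \<in> N then 0 else F' i t) \<longlonglongrightarrow> ?h t" for t
    proof (cases "t \<in> N")
      case False
      then have "\<forall>i. F i t = F' i t" using N(1) by auto
      then show ?thesis using F(2)[of t] False by simp
    qed simp
  qed
  moreover have "AE t in lborel. t \<notin> N"
    using N by (intro AE_not_in null_setsI) auto
  then have "AE t in lborel. f t = ?h t"
    by eventually_elim simp
  ultimately show thesis by (rule that)
qed

lemma L1_loc_causal_signal:
  assumes f: "L1_loc f"
  obtains h where "causal_signal h" "AE t in lborel. 0 \<le> t \<longrightarrow> f t = h t"
proof -
  let ?f = "\<lambda>t. indicator {0..} t *\<^sub>R f t"
  have int: "integrable lebesgue (\<lambda>t. indicator {0..T} t *\<^sub>R f t)" if "0 \<le> T" for T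
    using f that by (simp add: L1_loc_def set_integrable_def)
  have "?f \<in> borel_measurable lebesgue"
  proof (rule borel_measurable_LIMSEQ_metric)
    show "(\<lambda>t. indicator {0..real n} t *\<^sub>R f t) \<in> borel_measurable lebesgue" for n
      using int[of "real n"] by simp
    show "(\<lambda>n. indicator {0..real n} t *\<^sub>R f t) \<longlonglongrightarrow> ?f t" for t
    proof (rule tendsto_eventually)
      obtain n where "t \<le> real n" using real_arch_simple by blast
      then show "\<forall>\<^sub>F n in sequentially. indicator {0..real n} t *\<^sub>R f t = ?f t"
        by (intro eventually_sequentiallyI[of n]) (auto split: split_indicator)
    qed
  qed
  then obtain h0 where h0 [measurable]: "h0 \<in> borel_measurable borel" and ae0: "AE t in lborel. ?f t = h0 t"
    by (rule lebesgue_measurable_borel_representative)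
  define h where "h t = indicator {0..} t *\<^sub>R h0 t" for t
  have h [measurable]: "h \<in> borel_measurable borel"
    unfolding h_def by measurable
  have ae: "AE t in lborel. ?f t = h t"
    using ae0 by eventually_elim (auto simp: h_def split: split_indicator)
  have "(\<integral>\<^sup>+t. ennreal (norm (h t)) * indicator {..T} t \<partial>lborel) < \<infinity>" for T
  proof -
    have "AE t in lborel. indicator {0..max T 0} t *\<^sub>R f t = indicator {..max T 0} t *\<^sub>R h t"
      using ae by eventually_elim (auto split: split_indicator split_indicator_asm)
    then have "integrable lborel (\<lambda>t. indicator {..max T 0} t *\<^sub>R h t)"
      using int[of "max T 0"] by (subst lebesgue_integral_borel_representative(1)[symmetric]) auto
    then have "(\<integral>\<^sup>+t. norm (indicator {..max T 0} t *\<^sub>R h t) \<partial>lborel) < \<infinity>"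
      by (simp add: integrable_iff_bounded)
    moreover have "(\<integral>\<^sup>+t. ennreal (norm (h t)) * indicator {..T} t \<partial>lborel)
        \<le> (\<integral>\<^sup>+t. norm (indicator {..max T 0} t *\<^sub>R h t) \<partial>lborel)"
      by (intro nn_integral_mono) (auto split: split_indicator)
    ultimately show ?thesis by simp
  qed
  then have "causal_signal h"
    by (auto simp: causal_signal_def causal_density_def) (auto simp: h_def)
  moreover have "AE t in lborel. 0 \<le> t \<longrightarrow> f t = h t"
    using ae by eventually_elim (auto split: split_indicator_asm)
  ultimately show thesis by (rule that)
qed

lemma causal_signal_L1_loc:
  assumes h: "causal_signal h" and ae: "AE t in lborel. 0 \<le> t \<longrightarrow> f t = h t"
  shows "L1_loc f"
  unfolding L1_loc_def set_integrable_def
proof (intro allI impI)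
  fix T :: real assume "0 \<le> T"
  have [measurable]: "h \<in> borel_measurable borel" using h by (simp add: causal_signal_def)
  have "AE t in lborel. indicator {0..T} t *\<^sub>R f t = indicator {..T} t *\<^sub>R h t"
    using ae by eventually_elim (auto simp: causal_signal_negative[OF h] split: split_indicator)
  moreover have "integrable lborel (\<lambda>t. indicator {..T} t *\<^sub>R h t)"
  proof (rule integrableI_bounded)
    have "(\<integral>\<^sup>+t. ennreal (norm (indicator {..T} t *\<^sub>R h t)) \<partial>lborel)
        = (\<integral>\<^sup>+t. ennreal (norm (h t)) * indicator {..T} t \<partial>lborel)"
      by (intro nn_integral_cong) (auto split: split_indicator)
    then show "(\<integral>\<^sup>+t. ennreal (norm (indicator {..T} t *\<^sub>R h t)) \<partial>lborel) < \<infinity>"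
      using h by (simp add: causal_signal_def causal_density_def)
  qed measurable
  ultimately show "integrable lebesgue (\<lambda>t. indicator {0..T} t *\<^sub>R f t)"
    by (subst lebesgue_integral_borel_representative(1)[of "\<lambda>t. indicator {..T} t *\<^sub>R h t"]) auto
qed

text \<open>
  Equality holds at every \<open>t\<close>, since the integrands agree for almost every \<open>s\<close>: outside
  \<open>{0..t}\<close> one of the two causal factors vanishes.
\<close>

lemma convol_eq_line_convol:
  assumes P: "causal_kernel P" and h: "causal_signal h"
    and a: "AE t in lborel. 0 \<le> t \<longrightarrow> (\<forall>x. bop (a t) x = blinfun_apply (P t) x)"
    and b: "AE t in lborel. 0 \<le> t \<longrightarrow> b t = h t"
  shows "convol bop a b t = (P \<star> h) t"
proof -
  have [measurable]: "h \<in> borel_measurable borel" using h by (simp add: causal_signal_def)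
  have "AE s in lborel. indicator {0..t} s *\<^sub>R bop (a (t - s)) (b s) = blinfun_apply (P (t - s)) (h s)"
    using AE_reflect[OF a, of t] b
  proof eventually_elim
    fix s
    assume "0 \<le> t - s \<longrightarrow> (\<forall>x. bop (a (t - s)) x = blinfun_apply (P (t - s)) x)" "0 \<le> s \<longrightarrow> b s = h s"
    then show "indicator {0..t} s *\<^sub>R bop (a (t - s)) (b s) = blinfun_apply (P (t - s)) (h s)"
      using causal_signal_negative[OF h, of s] causal_kernel_negative[OF P, of "t - s"]
      by (auto split: split_indicator)
  qed
  then show ?thesis
    unfolding convol_def set_lebesgue_integral_def line_convol_def
    by (intro lebesgue_integral_borel_representative(2) causal_kernel_apply_measurable[OF P]) measurable
qed

text \<open>
  The family is set to zero off the half-line and on a Borel null set outside of which the operator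
  norm and the orbits of a countable dense set agree with Borel functions; the other orbits are limits
  of these. Every value of \<open>P\<close> is zero or a value of \<open>E\<close>, which preserves all homogeneous linear
  properties of \<open>E\<close> pointwise.
\<close>

lemma L1_loc_strong_causal_kernel:
  assumes E: "L1_loc_strong smul E"
  obtains P where "causal_kernel P" "AE t in lborel. 0 \<le> t \<longrightarrow> E t = P t"
    "\<forall>t. P t = 0 \<or> 0 \<le> t \<and> P t = E t"
proof -
  obtain C :: "'b set" where C: "countable C" "\<And>X. open X \<Longrightarrow> X \<noteq> {} \<Longrightarrow> \<exists>d\<in>C. d \<in> X"
    using countable_dense_setE by blast
  have "\<exists>e. e \<in> borel_measurable borel \<and>
      (AE t in lborel. indicator {0..} t *\<^sub>R blinfun_apply (E t) x = e t)" for x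
  proof -
    have "(\<lambda>t. indicator {0..} t *\<^sub>R blinfun_apply (E t) x) \<in> borel_measurable lebesgue"
      using E by (simp add: L1_loc_strong_def set_borel_measurable_def)
    then show ?thesis by (rule lebesgue_measurable_borel_representative) blast
  qed
  then obtain e where e [measurable]: "\<And>x. e x \<in> borel_measurable borel"
      and e_ae: "\<And>x. AE t in lborel. indicator {0..} t *\<^sub>R blinfun_apply (E t) x = e x t"
    by metis
  have "L1_loc (\<lambda>t. norm (E t))"
    using E by (simp add: L1_loc_strong_def)
  then obtain p where p: "causal_signal p" "AE t in lborel. 0 \<le> t \<longrightarrow> norm (E t) = p t"
    by (rule L1_loc_causal_signal)
  have "AE t in lborel. \<forall>d\<in>C. indicator {0..} t *\<^sub>R blinfun_apply (E t) d = e d t"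
    using C(1) e_ae by (simp add: AE_ball_countable)
  with p(2) have "AE t in lborel. (0 \<le> t \<longrightarrow> norm (E t) = p t) \<and>
      (\<forall>d\<in>C. indicator {0..} t *\<^sub>R blinfun_apply (E t) d = e d t)"
    by eventually_elim simp
  then obtain N where N: "{t \<in> space lborel. \<not> ((0 \<le> t \<longrightarrow> norm (E t) = p t) \<and>
      (\<forall>d\<in>C. indicator {0..} t *\<^sub>R blinfun_apply (E t) d = e d t))} \<subseteq> N"
      "emeasure lborel N = 0" "N \<in> sets lborel"
    by (rule AE_E)
  have off_N: "(0 \<le> t \<longrightarrow> norm (E t) = p t) \<and>
      (\<forall>d\<in>C. indicator {0..} t *\<^sub>R blinfun_apply (E t) d = e d t)" if "t \<notin> N" for t
    using N(1) that unfolding space_lborel space_borel by blast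
  have [measurable]: "N \<in> sets borel" using N(3) by simp
  define P where "P t = (if t \<in> N \<or> t < 0 then 0 else E t)" for t
  have P_C: "(\<lambda>t. blinfun_apply (P t) d) \<in> borel_measurable borel" if d: "d \<in> C" for d
  proof -
    have "blinfun_apply (P t) d = (if t \<in> N \<or> t < 0 then 0 else e d t)" for t
    proof (cases "t \<in> N \<or> t < 0")
      case False
      then have "indicator {0..} t *\<^sub>R blinfun_apply (E t) d = e d t" using off_N[of t] d by blast
      with False show ?thesis by (simp add: P_def)
    qed (auto simp: P_def)
    then show ?thesis by simp
  qed
  have "(\<lambda>t. blinfun_apply (P t) x) \<in> borel_measurable borel" for x
  proof -
    have "x \<in> closure C"
      using C(2) by (force simp: closure_iff_nhds_not_empty)
    then obtain X where X: "\<And>n. X n \<in> C" "X \<longlonglongrightarrow> x"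
      by (auto simp: closure_sequential)
    show ?thesis
    proof (rule borel_measurable_LIMSEQ_metric)
      show "(\<lambda>t. blinfun_apply (P t) (X n)) \<in> borel_measurable borel" for n
        using X(1) by (rule P_C)
      show "(\<lambda>n. blinfun_apply (P t) (X n)) \<longlonglongrightarrow> blinfun_apply (P t) x" for t
        using X(2) by (intro tendsto_intros)
    qed
  qed
  moreover have "ennreal (norm (P t)) \<le> ennreal (norm (p t))" for t
    using off_N[of t] by (auto simp: P_def intro!: ennreal_leI)
  ultimately have "causal_kernel P"
    using p(1) by (auto simp: causal_kernel_def causal_signal_def)
  moreover have "AE t in lborel. t \<notin> N"
    using N by (intro AE_not_in null_setsI) auto
  then have "AE t in lborel. 0 \<le> t \<longrightarrow> E t = P t"
    by eventually_elim (simp add: P_def)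
  ultimately show thesis
    by (rule that) (simp add: P_def)
qed

context separable_hilbert_space
begin

lemma bounded_bilinear_smul: "bounded_bilinear smul"
proof
  show "smul (r *\<^sub>R c) x = r *\<^sub>R smul c x" for r c x
    by (simp add: scaleR_conv_of_real scale_scale[symmetric] smul_of_real del: scale_scale)
  have "smul c (smul (of_real r) x) = smul (of_real r) (smul c x)" for r c x
    by (simp only: scale_scale mult.commute)
  then show "smul c (r *\<^sub>R x) = r *\<^sub>R smul c x" for r c x
    by (simp only: smul_of_real)
  show "\<exists>K. \<forall>c x. norm (smul c x) \<le> norm c * norm x * K"
    by (intro exI[of _ 1]) (simp add: norm_smul)
qed (simp_all add: scale_left_distrib scale_right_distrib)

definition scalar_kernel :: "(real \<Rightarrow> 's) \<Rightarrow> real \<Rightarrow> 'h \<Rightarrow>\<^sub>L 'h" where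
  "scalar_kernel k t = Blinfun (smul (k t))"

lemma scalar_kernel_apply [simp]: "blinfun_apply (scalar_kernel k t) x = smul (k t) x"
  unfolding scalar_kernel_def
  by (simp add: bounded_linear_Blinfun_apply bounded_bilinear.bounded_linear_right[OF bounded_bilinear_smul])

lemma causal_kernel_scalar:
  assumes k: "causal_signal k"
  shows "causal_kernel (scalar_kernel k)"
  unfolding causal_kernel_def
proof (intro conjI allI exI)
  have [measurable]: "k \<in> borel_measurable borel" using k by (simp add: causal_signal_def)
  have "continuous_on UNIV (\<lambda>c. smul c x)" for x
    using bounded_bilinear.bounded_linear_left[OF bounded_bilinear_smul] by (rule linear_continuous_on)
  then have "(\<lambda>t. smul (k t) x) \<in> borel_measurable borel" for x
    by (rule borel_measurable_continuous_on) measurable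
  then show "(\<lambda>t. blinfun_apply (scalar_kernel k t) x) \<in> borel_measurable borel" for x
    by simp
  show "causal_density (\<lambda>t. ennreal (norm (k t)))"
    using k by (simp add: causal_signal_def)
  show "ennreal (norm (scalar_kernel k t)) \<le> ennreal (norm (k t))" for t
    by (intro ennreal_leI norm_blinfun_bound) (simp_all add: norm_smul)
qed

end

lemma closed_operatorI:
  assumes "separable_hilbert_space smul" and A: "closed_densely_defined smul A D"
  shows "closed_operator A D"
proof
  interpret separable_hilbert_space smul by fact
  have D: "subspace D" by (simp add: A[unfolded closed_densely_defined_def])
  have A_add: "A (x + y) = A x + A y" if "x \<in> D" "y \<in> D" for x y
    using A that by (auto simp: closed_densely_defined_def)
  have A_smul: "A (smul c x) = smul c (A x)" if "x \<in> D" for c x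
    using A that by (auto simp: closed_densely_defined_def)
  show "closed ((\<lambda>x. (x, A x)) ` D)"
    using A by (simp add: closed_densely_defined_def)
  show "real_vector.subspace ((\<lambda>x. (x, A x)) ` D)"
  proof (rule real_vector.subspaceI)
    have "A 0 = 0"
      using A_smul[OF subspace_0[OF D], of 0] by simp
    then show "0 \<in> (\<lambda>x. (x, A x)) ` D"
      using subspace_0[OF D] by (force simp: zero_prod_def)
    show "x + y \<in> (\<lambda>x. (x, A x)) ` D" if "x \<in> (\<lambda>x. (x, A x)) ` D" "y \<in> (\<lambda>x. (x, A x)) ` D" for x y
      using that subspace_add[OF D] A_add by force
    show "r *\<^sub>R x \<in> (\<lambda>x. (x, A x)) ` D" if "x \<in> (\<lambda>x. (x, A x)) ` D" for r x
      using that subspace_scale[OF D, of _ "of_real r"] A_smul[of _ "of_real r"]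
      by (force simp: smul_of_real)
  qed
qed

context closed_operator
begin

lemma L1_loc_domI:
  assumes v: "causal_signal v" and w: "causal_signal w"
    and vw: "AE t in lborel. v t \<in> D \<and> A (v t) = w t"
  shows "L1_loc_dom A D v"
  unfolding L1_loc_dom_def AE_halfline_iff
proof (intro conjI)
  show "AE t in lborel. 0 \<le> t \<longrightarrow> v t \<in> D" using vw by eventually_elim simp
  show "L1_loc v" using v by (rule causal_signal_L1_loc) simp
  show "L1_loc (\<lambda>t. A (v t))" using w by (rule causal_signal_L1_loc) (use vw in eventually_elim, simp)
qed

lemma L1_loc_domE:
  assumes v: "causal_signal v" and dom: "L1_loc_dom A D v"
  obtains w where "causal_signal w" "AE t in lborel. v t \<in> D \<and> A (v t) = w t"
proof -
  have "L1_loc (\<lambda>t. A (v t))" using dom by (simp add: L1_loc_dom_def)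
  then obtain w where w: "causal_signal w" and ae: "AE t in lborel. 0 \<le> t \<longrightarrow> A (v t) = w t"
    by (rule L1_loc_causal_signal)
  have "AE t in lborel. 0 \<le> t \<longrightarrow> v t \<in> D" using dom by (simp add: L1_loc_dom_def AE_halfline_iff)
  with ae have "AE t in lborel. v t \<in> D \<and> A (v t) = w t"
  proof eventually_elim
    fix t assume "0 \<le> t \<longrightarrow> A (v t) = w t" "0 \<le> t \<longrightarrow> v t \<in> D"
    then show "v t \<in> D \<and> A (v t) = w t"
      using zero causal_signal_negative[OF v, of t] causal_signal_negative[OF w, of t]
      by (cases "t < 0") auto
  qed
  with w show thesis by (rule that)
qed

end

text \<open>
  The representatives are shown to satisfy the requirements of \<open>resolvent_pair\<close>. Under the integral of the
  resolvent equation, \<open>A (E s x)\<close> may be replaced by \<open>E s (A x)\<close>, a strongly measurable orbit.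
\<close>

lemma resolvent_family_pair:
  assumes "separable_hilbert_space smul" and k: "L1_loc k"
    and A: "closed_densely_defined smul A D" and E: "resolvent_family smul k A D k E"
  obtains K P where "resolvent_pair A D K P"
    "AE t in lborel. 0 \<le> t \<longrightarrow> (\<forall>x. smul (k t) x = blinfun_apply (K t) x)"
    "AE t in lborel. 0 \<le> t \<longrightarrow> (\<forall>x. blinfun_apply (E t) x = blinfun_apply (P t) x)"
proof -
  interpret separable_hilbert_space smul by fact
  interpret closed_operator A D using assms(1) A by (rule closed_operatorI)
  obtain \<kappa> where \<kappa>: "causal_signal \<kappa>" "AE t in lborel. 0 \<le> t \<longrightarrow> k t = \<kappa> t"
    using k by (rule L1_loc_causal_signal)
  have strong: "L1_loc_strong smul E" using E by (simp add: resolvent_family_def)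
  then obtain P where P: "causal_kernel P" and EP: "AE t in lborel. 0 \<le> t \<longrightarrow> E t = P t"
    and P_cases: "\<forall>t. P t = 0 \<or> 0 \<le> t \<and> P t = E t"
    by (rule L1_loc_strong_causal_kernel)
  let ?K = "scalar_kernel \<kappa>"
  have K: "causal_kernel ?K" using \<kappa>(1) by (rule causal_kernel_scalar)
  have kK: "AE t in lborel. 0 \<le> t \<longrightarrow> (\<forall>x. smul (k t) x = blinfun_apply (?K t) x)"
    using \<kappa>(2) by eventually_elim simp
  have E_ae: "AE t in lborel. 0 \<le> t \<longrightarrow> (\<forall>x\<in>D. blinfun_apply (E t) x \<in> D \<and>
        A (blinfun_apply (E t) x) = blinfun_apply (E t) (A x) \<and>
        blinfun_apply (E t) x = smul (k t) x + convol smul k (\<lambda>s. A (blinfun_apply (E s) x)) t)"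
    using E by (simp add: resolvent_family_def AE_halfline_iff)
  have conv: "convol smul k (\<lambda>s. A (blinfun_apply (E s) x)) t = (?K \<star> (\<lambda>s. blinfun_apply (P s) (A x))) t"
    if x: "x \<in> D" for x t
  proof (rule convol_eq_line_convol[where bop=smul and a=k, OF K causal_signal_kernel_apply[OF P] kK])
    show "AE s in lborel. 0 \<le> s \<longrightarrow> A (blinfun_apply (E s) x) = blinfun_apply (P s) (A x)"
      using E_ae EP by eventually_elim (use x in auto)
  qed
  have "resolvent_pair A D ?K P"
  proof
    show "closure D = UNIV" using A by (simp add: closed_densely_defined_def)
    show "blinfun_apply (?K s) (blinfun_apply (P t) x) = blinfun_apply (P t) (blinfun_apply (?K s) x)" for s t x
      using strong P_cases[rule_format, of t] by (auto simp: L1_loc_strong_def)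
    show "AE t in lborel. \<forall>x\<in>D. blinfun_apply (?K t) x \<in> D \<and> A (blinfun_apply (?K t) x) = blinfun_apply (?K t) (A x)"
      using A subspace_scale[of D] by (simp add: closed_densely_defined_def)
    show "AE t in lborel. \<forall>x\<in>D. blinfun_apply (P t) x \<in> D \<and> A (blinfun_apply (P t) x) = blinfun_apply (P t) (A x)"
      using E_ae
    proof eventually_elim
      fix t assume "0 \<le> t \<longrightarrow> (\<forall>x\<in>D. blinfun_apply (E t) x \<in> D \<and>
        A (blinfun_apply (E t) x) = blinfun_apply (E t) (A x) \<and>
        blinfun_apply (E t) x = smul (k t) x + convol smul k (\<lambda>s. A (blinfun_apply (E s) x)) t)"
      then show "\<forall>x\<in>D. blinfun_apply (P t) x \<in> D \<and> A (blinfun_apply (P t) x) = blinfun_apply (P t) (A x)"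
        using P_cases[rule_format, of t] zero by auto
    qed
    show "AE t in lborel. \<forall>x\<in>D.
        blinfun_apply (P t) x = blinfun_apply (?K t) x + (?K \<star> (\<lambda>s. blinfun_apply (P s) (A x))) t"
      using E_ae EP \<kappa>(2)
    proof eventually_elim
      fix t assume t: "0 \<le> t \<longrightarrow> (\<forall>x\<in>D. blinfun_apply (E t) x \<in> D \<and>
        A (blinfun_apply (E t) x) = blinfun_apply (E t) (A x) \<and>
        blinfun_apply (E t) x = smul (k t) x + convol smul k (\<lambda>s. A (blinfun_apply (E s) x)) t)"
        "0 \<le> t \<longrightarrow> E t = P t" "0 \<le> t \<longrightarrow> k t = \<kappa> t"
      show "\<forall>x\<in>D. blinfun_apply (P t) x = blinfun_apply (?K t) x + (?K \<star> (\<lambda>s. blinfun_apply (P s) (A x))) t"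
      proof
        fix x assume x: "x \<in> D"
        have sig: "causal_signal (?K \<star> (\<lambda>s. blinfun_apply (P s) (A x)))"
          by (intro causal_signal_convolution K causal_signal_kernel_apply P)
        show "blinfun_apply (P t) x = blinfun_apply (?K t) x + (?K \<star> (\<lambda>s. blinfun_apply (P s) (A x))) t"
        proof (cases "t < 0")
          case True
          then show ?thesis
            using causal_signal_negative[OF sig] causal_kernel_negative[OF P] causal_kernel_negative[OF K]
            by (simp del: scalar_kernel_apply)
        next
          case False
          then show ?thesis using t x conv[OF x, of t] by auto
        qed
      qed
    qed
  qed (fact K P)+
  moreover have "AE t in lborel. 0 \<le> t \<longrightarrow> (\<forall>x. blinfun_apply (E t) x = blinfun_apply (P t) x)"
    using EP by eventually_elim simp
  ultimately show thesis using kK by - (rule that)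
qed

section \<open>Existence and uniqueness of mild solutions\<close>

theorem theorem3p14:
  fixes smul :: "'s::{real_normed_field,banach,second_countable_topology} \<Rightarrow>
      'h::{real_inner,banach,second_countable_topology} \<Rightarrow> 'h"
    and k :: "real \<Rightarrow> 's"
    and A :: "'h \<Rightarrow> 'h" and D :: "'h set"
    and E :: "real \<Rightarrow> 'h \<Rightarrow>\<^sub>L 'h"
    and g :: "real \<Rightarrow> 'h"
  assumes "separable_hilbert_space smul"
    and "L1_loc k" and "\<not> (\<forall>\<^sub>a\<^sub>e t. k t = 0)"
    and "closed_densely_defined smul A D"
    and "resolvent_family smul k A D k E"
    and "L1_loc g"
  shows "(L1_loc_dom A D (convol blinfun_apply E g) \<longrightarrow>
            mild_solution smul k A D g (solution_map A E g) \<and>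
            (\<forall>u. mild_solution smul k A D g u \<longrightarrow> (\<forall>\<^sub>a\<^sub>e t. u t = solution_map A E g t))) \<and>
         (\<forall>u. mild_solution smul k A D g u \<longrightarrow>
            L1_loc_dom A D (convol blinfun_apply E g) \<and> (\<forall>\<^sub>a\<^sub>e t. u t = solution_map A E g t))"
proof -
  obtain K P where "resolvent_pair A D K P"
    and kK: "AE t in lborel. 0 \<le> t \<longrightarrow> (\<forall>x. smul (k t) x = blinfun_apply (K t) x)"
    and EP: "AE t in lborel. 0 \<le> t \<longrightarrow> (\<forall>x. blinfun_apply (E t) x = blinfun_apply (P t) x)"
    using assms(1,2,4,5) by (rule resolvent_family_pair)
  then interpret resolvent_pair A D K P by simp
  obtain \<gamma> where \<gamma>: "causal_signal \<gamma>" and g\<gamma>: "AE t in lborel. 0 \<le> t \<longrightarrow> g t = \<gamma> t"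
    using assms(6) by (rule L1_loc_causal_signal)
  have Eg: "convol blinfun_apply E g = P \<star> \<gamma>"
    using convol_eq_line_convol[where bop=blinfun_apply and a=E, OF E \<gamma> EP g\<gamma>] by blast
  have P\<gamma>: "causal_signal (P \<star> \<gamma>)"
    using E \<gamma> by (rule causal_signal_convolution)
  have converse: "L1_loc_dom A D (convol blinfun_apply E g) \<and> (\<forall>\<^sub>a\<^sub>e t. u t = solution_map A E g t)"
    if mild: "mild_solution smul k A D g u" for u
  proof -
    have "L1_loc u" using mild by (simp add: mild_solution_def)
    then obtain \<upsilon> where \<upsilon>: "causal_signal \<upsilon>" and u\<upsilon>: "AE t in lborel. 0 \<le> t \<longrightarrow> u t = \<upsilon> t"
      by (rule L1_loc_causal_signal)
    have ku: "convol smul k u = K \<star> \<upsilon>"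
      using convol_eq_line_convol[where bop=smul and a=k, OF K \<upsilon> kK u\<upsilon>] by blast
    have "L1_loc_dom A D (K \<star> \<upsilon>)"
      using mild ku by (simp add: mild_solution_def)
    with causal_signal_convolution[OF K \<upsilon>] obtain w where w: "causal_signal w"
      and Kw: "AE t in lborel. (K \<star> \<upsilon>) t \<in> D \<and> A ((K \<star> \<upsilon>) t) = w t"
      by (rule L1_loc_domE)
    have u_eq: "AE t in lborel. 0 \<le> t \<longrightarrow> u t = g t + A ((K \<star> \<upsilon>) t)"
      using mild ku by (simp add: mild_solution_def AE_halfline_iff)
    have "AE t in lborel. (K \<star> \<upsilon>) t \<in> D \<and> A ((K \<star> \<upsilon>) t) = \<upsilon> t - \<gamma> t"
      using Kw u_eq u\<upsilon> g\<gamma>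
    proof eventually_elim
      fix t assume "(K \<star> \<upsilon>) t \<in> D \<and> A ((K \<star> \<upsilon>) t) = w t" "0 \<le> t \<longrightarrow> u t = g t + A ((K \<star> \<upsilon>) t)"
        "0 \<le> t \<longrightarrow> u t = \<upsilon> t" "0 \<le> t \<longrightarrow> g t = \<gamma> t"
      then show "(K \<star> \<upsilon>) t \<in> D \<and> A ((K \<star> \<upsilon>) t) = \<upsilon> t - \<gamma> t"
        using causal_signal_negative[OF \<upsilon>, of t] causal_signal_negative[OF \<gamma>, of t]
          causal_signal_negative[OF w, of t]
        by (cases "t < 0") auto
    qed
    then have eq: "AE t in lborel. (K \<star> \<upsilon>) t = (P \<star> \<gamma>) t"
      by (rule mild_solution_convolution[OF \<upsilon> \<gamma>])
    have "L1_loc_dom A D (P \<star> \<gamma>)"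
      using P\<gamma> w by (rule L1_loc_domI) (use Kw eq in \<open>eventually_elim, simp\<close>)
    moreover have "AE t in lborel. 0 \<le> t \<longrightarrow> u t = g t + A ((P \<star> \<gamma>) t)"
      using u_eq eq by eventually_elim simp
    ultimately show ?thesis
      by (simp add: Eg AE_halfline_iff solution_map_def)
  qed
  moreover have "mild_solution smul k A D g (solution_map A E g)"
    if "L1_loc_dom A D (convol blinfun_apply E g)"
  proof -
    have "L1_loc_dom A D (P \<star> \<gamma>)" using that by (simp add: Eg)
    with P\<gamma> obtain a where a: "causal_signal a"
      and Pa: "AE t in lborel. (P \<star> \<gamma>) t \<in> D \<and> A ((P \<star> \<gamma>) t) = a t"
      by (rule L1_loc_domE)
    let ?u = "solution_map A E g" and ?\<upsilon> = "\<lambda>t. \<gamma> t + a t"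
    have \<upsilon>: "causal_signal ?\<upsilon>" using \<gamma> a by (rule causal_signal_add)
    have u\<upsilon>: "AE t in lborel. 0 \<le> t \<longrightarrow> ?u t = ?\<upsilon> t"
      using g\<gamma> Pa by eventually_elim (simp add: solution_map_def Eg)
    have ku: "convol smul k ?u = K \<star> ?\<upsilon>"
      using convol_eq_line_convol[where bop=smul and a=k, OF K \<upsilon> kK u\<upsilon>] by blast
    have eq: "AE t in lborel. (K \<star> ?\<upsilon>) t = (P \<star> \<gamma>) t"
      by (rule convolution_of_solution_formula[OF \<gamma> a \<upsilon> Pa]) simp
    have "L1_loc ?u" using \<upsilon> u\<upsilon> by (rule causal_signal_L1_loc)
    moreover have "L1_loc_dom A D (K \<star> ?\<upsilon>)"
      using causal_signal_convolution[OF K \<upsilon>] a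
      by (rule L1_loc_domI) (use Pa eq in \<open>eventually_elim, simp\<close>)
    moreover have "AE t in lborel. 0 \<le> t \<longrightarrow> ?u t = g t + A ((K \<star> ?\<upsilon>) t)"
      using eq by eventually_elim (simp add: solution_map_def Eg)
    ultimately show ?thesis
      by (simp add: mild_solution_def ku AE_halfline_iff)
  qed
  ultimately show ?thesis by blast
qed

end
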